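(* Let $d,m$ be positive integers, $W$ a finite set, and $M$ the independence complex of a matroid on $W$ of rank greater than or equal to $d+1$, with rank function $\rho$. For each $w\in W$, let $X^w=\{x^w_1,\dots,x^w_m\}\subset\mathbb{R}^{d-1}$ be an (indexed) set of points. For every $w\in W$ and $i\in[m]$, let $A^w_i$ be a closed subset of $S^d$. Assume that: (1) for all $W'\subseteq W$ such that $\rho(W\setminus W')\le d$, we have $S^d=\bigcup_{w\in W'}\bigcup_{i=1}^m\left(A^w_i\cup(-A^w_i)\right)$; (2) for every pair of elements $u,w\in W$ such that $\{u,w\}\in M$ and every $i\in[m]$, we have $A^u_i\cap(-A^w_i)=\emptyset$. Then there exist $x\in S^d$ and two nonempty disjoint sets $P_+,P_-\subseteq W\times[m]$ such that: (a) $\operatorname{conv}\{x^w_i:(w,i)\in P_+\}\cap\operatorname{conv}\{x^w_i:(w,i)\in P_-\}\neq\emptyset$; (b) $x\in\left(\bigcap_{(w,i)\in P_+}A^w_i\right)\cap\left(\bigcap_{(w,i)\in P_-}(-A^w_i)\right)$; (c) the projection $\pi_1:P_+\cup P_-\to W$ onto the first coordinate is injective, and $\pi_1(P_+\cup P_-)\in M$ and has rank $d+1$; and the projection $\pi_2:W\times[m]\to[m]$ onto the second coordinate satisfies $\pi_2(P_+)\cap\pi_2(P_-)=\emptyset$.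
   Context: Notation: $[m]=\{1,\dots,m\}$; $S^d$ is the unit sphere in $\mathbb{R}^{d+1}$ and $-A=\{-x:x\in A\}$. The independence complex of a matroid is the simplicial complex of its independent sets. *)

theory Defs
  imports "HOL-Homology.Homology" "HOL-Library.Function_Algebras"
begin

text \<open>\<open>Euclidean_space n\<close> and \<open>nsphere n\<close> live in the type \<open>nat \<Rightarrow> real\<close>, the coordinates
  being those with index below \<open>n\<close> (resp. \<open>Suc n\<close>), with all others zero; this makes the zero-dimensional
  space available and lets the dimension be a variable. The pointwise vector space structure
  makes the library's \<open>convex hull\<close> applicable to such points.\<close>

instantiation "fun" :: (type, real_vector) real_vector
begin

definition scaleR_fun :: "real \<Rightarrow> ('a \<Rightarrow> 'b) \<Rightarrow> 'a \<Rightarrow> 'b"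
  where "scaleR_fun c f = (\<lambda>x. c *\<^sub>R f x)"

instance
  by standard (simp_all add: scaleR_fun_def fun_eq_iff plus_fun_def scaleR_add_right scaleR_add_left)

end

definition matroid :: "'w set \<Rightarrow> 'w set set \<Rightarrow> bool"
  where "matroid W M \<longleftrightarrow>
    finite W \<and> M \<subseteq> Pow W \<and> {} \<in> M \<and>
    (\<forall>I\<in>M. \<forall>J. J \<subseteq> I \<longrightarrow> J \<in> M) \<and>
    (\<forall>I\<in>M. \<forall>J\<in>M. card I < card J \<longrightarrow> (\<exists>e\<in>J - I. insert e I \<in> M))"

definition matroid_rank :: "'w set set \<Rightarrow> 'w set \<Rightarrow> nat"
  where "matroid_rank M S = Max (card ` {I \<in> M. I \<subseteq> S})"

end

theory Submission
  imports Defs "HOL-Library.Z2" "HOL-Analysis.Abstract_Topological_Spaces"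
begin

text \<open>Call a triple \<open>(w, i, s)\<close> a label, with \<open>s\<close> a sign, and say that it holds at a point \<open>x\<close> of the
  sphere if \<open>s x\<close> lies in \<open>A w i\<close>. The sets of labels with distinct first coordinates that form a
  member of \<open>M\<close> are again the independent sets of a matroid, a parallel extension of \<open>M\<close>, and
  reversing signs is a symmetry of it. The covering hypothesis, applied at \<open>x\<close> to the \<open>w\<close> without a label
  that holds, says that the labels holding at \<open>x\<close> have rank at least \<open>d + 1\<close>.

  The independence complex of a matroid of rank \<open>r\<close> has no reduced homology below dimension \<open>r - 1\<close>
  (\<open>matroid_cycle_bounds\<close>). Hence the labels holding somewhere on a cell form an acyclic carrier, and
  there is an antipodal chain map, modulo 2, from a centrally symmetric cell structure of the
  sphere to the complex of labels, each cell going to labels that hold somewhere on it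
  (\<open>equivariant_chain_map_below\<close>).

  Send a label \<open>(w, i, s)\<close> to the vector \<open>s (X w i, 1)\<close> of \<open>d\<close>-dimensional space. This is odd, so
  a Borsuk-Ulam argument at the level of chains (\<open>antipodal_zero\<close>) yields a cell and an independent
  set of \<open>d + 1\<close> of its labels whose vectors have \<open>0\<close> in their convex hull. The argument is a parity
  count. If \<open>H k\<close> is a \<open>k\<close>-dimensional hemisphere, then the boundary of \<open>H (k + 1)\<close> is \<open>H k\<close> plus its
  antipode. For vectors in general position, the number of simplices in the image of \<open>H k\<close> with a
  convex combination of their vectors that vanishes in the first \<open>k\<close> coordinates is congruent
  modulo 2 to the same number for \<open>k + 1\<close>. For \<open>k = 0\<close> it is odd, and for \<open>k = d\<close> it counts the
  simplices whose convex hull contains the origin.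

  Refining the cells and undoing the perturbation to general position, compactness gives a single
  point \<open>x\<close> at which all \<open>d + 1\<close> labels hold, with \<open>0\<close> an exact convex combination of their vectors
  (\<open>exact_zero\<close>). Now let \<open>P\<close> and \<open>Q\<close> be the positive and the negative labels. The last coordinate says
  that both carry the same total weight, so both are nonempty; the other coordinates then say that
  their weighted means agree. An index \<open>i\<close> common to labels of \<open>P\<close> and \<open>Q\<close> would put \<open>x\<close> into some
  \<open>A u i\<close> and some \<open>- A w i\<close> with \<open>{u, w}\<close> in \<open>M\<close>, which the disjointness hypothesis excludes.\<close>

section \<open>Sums modulo 2\<close>

text \<open>These two rules turn sums and products of bits into bitwise operations, which hides the ring
  structure that all computations below rely on.\<close>

declare add_bit_eq_xor [simp del] mult_bit_eq_and [simp del]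

lemma bit_add_self [simp]: "x + x = (0::bit)"
  by (cases x) (simp_all flip: mult_2)

lemma bit_add_eq_0_iff: "x + y = 0 \<longleftrightarrow> x = (y::bit)"
  by (cases x; cases y) simp_all

lemma bit_sum_of_bool:
  assumes "finite S"
  shows "(\<Sum>v\<in>S. of_bool (P v)) = (of_bool (odd (card {v\<in>S. P v})) :: bit)"
  using assms
proof (induction S)
  case (insert a S)
  have "{v \<in> insert a S. P v} = (if P a then insert a {v\<in>S. P v} else {v\<in>S. P v})"
    by auto
  then show ?case using insert by auto
qed simp

lemma bit_sum_involution:
  fixes f :: "'a \<Rightarrow> bit"
  assumes "finite S"
    and "\<And>x. x \<in> S \<Longrightarrow> \<tau> x \<in> S" "\<And>x. x \<in> S \<Longrightarrow> \<tau> (\<tau> x) = x"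
    and "\<And>x. x \<in> S \<Longrightarrow> \<tau> x \<noteq> x" "\<And>x. x \<in> S \<Longrightarrow> f (\<tau> x) = f x"
  shows "sum f S = 0"
  using assms
proof (induction "card S" arbitrary: S rule: less_induct)
  case less
  show ?case
  proof (cases "S = {}")
    case False
    then obtain x where x: "x \<in> S" by blast
    let ?R = "S - {x, \<tau> x}"
    have "card ?R < card S"
      using x less.prems(1) by (intro psubset_card_mono) auto
    moreover have "\<tau> y \<in> ?R" if "y \<in> ?R" for y
      using that x less.prems(2,3) by (metis Diff_iff insert_iff singletonD)
    ultimately have "sum f ?R = 0"
      using less.prems by (intro less.hyps) auto
    moreover have "sum f S = sum f ?R + sum f {x, \<tau> x}"
      using x less.prems(1,2) by (intro sum.subset_diff) auto
    moreover have "sum f {x, \<tau> x} = 0"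
      using x less.prems(4)[of x] less.prems(5)[of x] by auto
    ultimately show ?thesis by simp
  qed simp
qed

section \<open>Acyclicity of matroid complexes below the top dimension\<close>

text \<open>Chains modulo 2 are indicator functions on sets of vertices. The empty set counts as a simplex of
  dimension \<open>-1\<close>, so that cycles are reduced cycles and a set of size \<open>n\<close> has dimension \<open>n - 1\<close>.\<close>

definition bdry :: "'a set \<Rightarrow> ('a set \<Rightarrow> bit) \<Rightarrow> 'a set \<Rightarrow> bit"
  where "bdry E z J = (\<Sum>v\<in>E - J. z (insert v J))"

definition cone_chain :: "'a \<Rightarrow> ('a set \<Rightarrow> bit) \<Rightarrow> 'a set \<Rightarrow> bit"
  where "cone_chain e z J = (if e \<in> J then z (J - {e}) else 0)"

lemma bdry_cone_chain:
  assumes "finite E" "e \<in> E" and avoid: "\<And>J. e \<in> J \<Longrightarrow> z J = 0"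
  shows "bdry E (cone_chain e z) J = (if e \<in> J then bdry E z (J - {e}) else z J)"
proof (cases "e \<in> J")
  case True
  have zero: "z (insert e K) = 0" for K
    using avoid by blast
  have "bdry E z (J - {e}) = (\<Sum>v\<in>insert e (E - J). z (insert v (J - {e})))"
    unfolding bdry_def using True assms(2) by (intro sum.cong) auto
  also have "\<dots> = (\<Sum>v\<in>E - J. z (insert v (J - {e})))"
    using True assms(1) by (subst sum.insert) (auto simp: zero)
  also have "\<dots> = bdry E (cone_chain e z) J"
    unfolding bdry_def cone_chain_def using True
    by (intro sum.cong) (auto simp: insert_Diff_if)
  finally show ?thesis using True by simp
next
  case False
  have "bdry E (cone_chain e z) J = (\<Sum>v\<in>E - J. if v = e then z J else 0)"
    unfolding bdry_def cone_chain_def using False by (intro sum.cong) auto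
  then show ?thesis using False assms(1,2) by simp
qed

lemma bdry_add: "bdry E (\<lambda>J. z J + z' J) J = bdry E z J + bdry E z' J"
  by (simp add: bdry_def sum.distrib)

lemma bdry_sum: "bdry E (\<lambda>J. \<Sum>c\<in>C. z c J) J = (\<Sum>c\<in>C. bdry E (z c) J)"
  unfolding bdry_def by (rule sum.swap)

lemma matroid_finite:
  assumes "matroid E M" "I \<in> M"
  shows "finite I"
  using assms unfolding matroid_def by (meson PowD finite_subset subsetD)

lemma matroid_subset:
  assumes "matroid E M" "I \<in> M" "J \<subseteq> I"
  shows "J \<in> M"
  using assms unfolding matroid_def by blast

lemma matroid_exchange:
  assumes "matroid E M" "I \<in> M" "J \<in> M" "card I < card J"
  obtains e where "e \<in> J - I" "insert e I \<in> M"
  using assms unfolding matroid_def by blast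

lemma matroid_restrict:
  assumes "matroid E N" "B \<subseteq> E"
  shows "matroid B {I\<in>N. I \<subseteq> B}"
  unfolding matroid_def
proof (intro conjI ballI allI impI)
  show "finite B" using assms finite_subset unfolding matroid_def by metis
next
  fix I J assume IJ: "I \<in> {I\<in>N. I \<subseteq> B}" "J \<in> {I\<in>N. I \<subseteq> B}" "card I < card J"
  then obtain e where "e \<in> J - I" "insert e I \<in> N"
    using matroid_exchange[OF assms(1), of I J] by blast
  then show "\<exists>e\<in>J - I. insert e I \<in> {I\<in>N. I \<subseteq> B}" using IJ by blast
next
  fix I J assume "I \<in> {I\<in>N. I \<subseteq> B}" "J \<subseteq> I"
  then show "J \<in> {I\<in>N. I \<subseteq> B}" using matroid_subset[OF assms(1), of I J] by blast
qed (use assms(1) in \<open>auto simp: matroid_def\<close>)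

lemma matroid_delete:
  assumes "matroid (insert e B) M" "e \<notin> B"
  shows "matroid B {I\<in>M. e \<notin> I}"
proof -
  have "{I\<in>M. e \<notin> I} = {I\<in>M. I \<subseteq> B}"
    using assms unfolding matroid_def by blast
  then show ?thesis
    using matroid_restrict[OF assms(1), of B] by auto
qed

lemma matroid_contract:
  assumes M: "matroid (insert e B) M" and "e \<notin> B" "{e} \<in> M"
  shows "matroid B {I. e \<notin> I \<and> insert e I \<in> M}"
  unfolding matroid_def
proof (intro conjI ballI allI impI)
  fix I J assume I: "I \<in> {I. e \<notin> I \<and> insert e I \<in> M}" and J: "J \<in> {I. e \<notin> I \<and> insert e I \<in> M}"
    and less: "card I < card J"
  have "finite (insert e I)" "finite (insert e J)"
    using matroid_finite[OF M, of "insert e I"] matroid_finite[OF M, of "insert e J"] I J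
    by (simp_all del: finite_insert)
  then have "card (insert e I) < card (insert e J)"
    using I J less by simp
  then obtain f where "f \<in> insert e J - insert e I" "insert f (insert e I) \<in> M"
    using matroid_exchange[OF M, of "insert e I" "insert e J"] I J by blast
  then show "\<exists>f\<in>J - I. insert f I \<in> {I. e \<notin> I \<and> insert e I \<in> M}"
    using I by (intro bexI[of _ f]) (auto simp: insert_commute)
next
  fix I J assume "I \<in> {I. e \<notin> I \<and> insert e I \<in> M}" "J \<subseteq> I"
  then have "insert e J \<subseteq> insert e I" "insert e I \<in> M" "e \<notin> J" by auto
  then show "J \<in> {I. e \<notin> I \<and> insert e I \<in> M}"
    using matroid_subset[OF M] by blast
qed (use assms in \<open>auto simp: matroid_def\<close>)

lemma matroid_augment:
  assumes M: "matroid E M" and "I \<in> M" "J \<in> M" "card I \<le> card J"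
  shows "\<exists>K\<in>M. I \<subseteq> K \<and> card K = card J"
  using assms(2-)
proof (induction "card J - card I" arbitrary: I)
  case 0
  then show ?case by (intro bexI[of _ I]) auto
next
  case (Suc k)
  then obtain e where e: "e \<in> J - I" "insert e I \<in> M"
    using matroid_exchange[OF M, of I J] by (metis zero_less_Suc zero_less_diff)
  moreover have "finite I"
    using matroid_finite[OF M Suc.prems(1)] .
  ultimately have "k = card J - card (insert e I)" "card (insert e I) \<le> card J"
    using Suc.hyps(2) by auto
  then show ?case
    using Suc.hyps(1)[of "insert e I"] e(2) Suc.prems(2) by blast
qed

text \<open>Induction on the ground set, where a loop \<open>e\<close> can be dropped. Otherwise write the cycle as \<open>z = e * a + b\<close> with \<open>e\<close> in neither \<open>a\<close> nor \<open>b\<close>. Then \<open>a\<close> is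
  a cycle one dimension lower in the contraction by \<open>e\<close>, whose rank is also one lower, so \<open>a\<close> is
  the boundary of some \<open>a'\<close>. Subtracting the boundary of the cone \<open>e * a'\<close> from \<open>z\<close> leaves
  \<open>b + a'\<close>, a cycle of the deletion of \<open>e\<close>. If the deletion still has rank above \<open>n\<close>, induction applies; if not,
  \<open>e\<close> is a coloop and the cycle bounds the cone over itself with apex \<open>e\<close>.\<close>

lemma matroid_cycle_bounds:
  assumes "finite E" "B \<subseteq> E" "matroid B M" "I \<in> M" "n < card I"
    and "\<And>J. z J \<noteq> 0 \<Longrightarrow> J \<in> M \<and> card J = n"
    and "\<And>J. bdry E z J = 0"
  shows "\<exists>c. (\<forall>J. c J \<noteq> 0 \<longrightarrow> J \<in> M \<and> card J = Suc n) \<and> (\<forall>J. bdry E c J = z J)"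
proof -
  have "finite B" using assms(1,2) finite_subset by blast
  then show ?thesis using assms(2-)
  proof (induction B arbitrary: M n z I)
    case empty
    then show ?case by (auto simp: matroid_def)
  next
    case (insert e B)
    note M = insert.prems(2) and z = insert.prems(5) and cyc = insert.prems(6)
    have fin: "finite J" if "J \<in> M" for J
      using matroid_finite[OF M that] .
    have down: "K \<in> M" if "J \<in> M" "K \<subseteq> J" for J K
      using matroid_subset[OF M that] .
    have eE: "e \<in> E" and BE: "B \<subseteq> E" using insert.prems(1) by auto
    show ?case
    proof (cases "{e} \<in> M")
      case False
      then have "M = {I\<in>M. e \<notin> I}"
        using down by auto
      then have "matroid B M"
        using matroid_delete[OF M insert.hyps(2)] by simp
      then show ?thesis
        using insert.IH[of M I n z] insert.prems BE by blast
    next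
      case True
      define D where "D = {I\<in>M. e \<notin> I}"
      define a where "a J = (if e \<in> J then 0 else z (insert e J))" for J
      define b where "b J = (if e \<in> J then 0 else z J)" for J
      have a_e: "a J = 0" and b_e: "b J = 0" if "e \<in> J" for J
        using that by (auto simp: a_def b_def)
      have bd_e: "bdry E a J = 0" "bdry E b J = 0" if "e \<in> J" for J
        using that by (auto simp: bdry_def a_def b_def)
      have split: "bdry E z J = (if e \<in> J then bdry E a (J - {e}) else a J + bdry E b J)" for J
      proof (cases "e \<in> J")
        case True
        have "bdry E z J = (\<Sum>v\<in>E - J. a (insert v (J - {e})))"
          unfolding bdry_def a_def using True
          by (intro sum.cong) (auto intro!: arg_cong[where f=z])
        also have "\<dots> = (\<Sum>v\<in>insert e (E - J). a (insert v (J - {e})))"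
          using True assms(1) by (subst sum.insert) (auto simp: a_e)
        also have "\<dots> = bdry E a (J - {e})"
          unfolding bdry_def using True eE by (intro sum.cong) auto
        finally show ?thesis using True by simp
      next
        case False
        have "E - J = insert e (E - J - {e})" using False eE by auto
        then have "bdry E z J = (\<Sum>v\<in>insert e (E - J - {e}). z (insert v J))"
          by (simp add: bdry_def)
        also have "\<dots> = z (insert e J) + (\<Sum>v\<in>E - J - {e}. z (insert v J))"
          using assms(1) by (subst sum.insert) auto
        also have "(\<Sum>v\<in>E - J - {e}. z (insert v J)) = (\<Sum>v\<in>E - J - {e}. b (insert v J))"
          unfolding b_def using False by (intro sum.cong) auto
        also have "\<dots> = (\<Sum>v\<in>insert e (E - J - {e}). b (insert v J))"
          using assms(1) by (subst sum.insert) (auto simp: b_e)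
        also have "insert e (E - J - {e}) = E - J" using False eE by auto
        finally show ?thesis using False by (simp add: a_def bdry_def)
      qed
      have cyc_a: "bdry E a J = 0" for J
        using split[of "insert e J"] cyc[of "insert e J"] bd_e(1)[of J]
        by (cases "e \<in> J") auto
      have bd_b: "bdry E b J = a J" for J
        using split[of J] cyc[of J] bd_e(2)[of J] a_e[of J]
        by (cases "e \<in> J") (auto simp: bit_add_eq_0_iff)
      have mD: "matroid B D"
        unfolding D_def by (rule matroid_delete[OF M insert.hyps(2)])
      have bD: "J \<in> D \<and> card J = n" if "b J \<noteq> 0" for J
        using z[of J] that by (auto simp: b_def D_def split: if_splits)
      \<comment> \<open>the link part of \<open>z\<close> bounds inside the contraction, whose rank is one less\<close>
      have "\<exists>a'. (\<forall>J. a' J \<noteq> 0 \<longrightarrow> e \<notin> J \<and> insert e J \<in> M \<and> card J = n) \<and> (\<forall>J. bdry E a' J = a J)"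
      proof (cases n)
        case 0
        have "a J = 0" for J
        proof (cases "z (insert e J) = 0")
          case False
          then have *: "insert e J \<in> M" "card (insert e J) = 0"
            using z[of "insert e J"] 0 by simp_all
          then show ?thesis using fin[OF *(1)] by (metis card_0_eq insert_not_empty)
        qed (simp add: a_def)
        then show ?thesis by (intro exI[of _ "\<lambda>_. 0"]) (simp add: bdry_def)
      next
        case (Suc n')
        obtain I' where I': "I' \<in> M" "{e} \<subseteq> I'" "card I' = card I"
          using matroid_augment[OF M True insert.prems(3)] insert.prems(4) by auto
        have "\<exists>c. (\<forall>J. c J \<noteq> 0 \<longrightarrow> J \<in> {I. e \<notin> I \<and> insert e I \<in> M} \<and> card J = Suc n') \<and>
              (\<forall>J. bdry E c J = a J)"
        proof (rule insert.IH)
          show "matroid B {I. e \<notin> I \<and> insert e I \<in> M}"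
            using matroid_contract[OF M insert.hyps(2) True] .
          show "I' - {e} \<in> {I. e \<notin> I \<and> insert e I \<in> M}"
            using I' by (auto simp: insert_absorb)
          show "n' < card (I' - {e})"
            using I' fin[of I'] insert.prems(4) Suc by auto
          show "J \<in> {I. e \<notin> I \<and> insert e I \<in> M} \<and> card J = n'" if "a J \<noteq> 0" for J
            using that z[of "insert e J"] fin[of "insert e J"] Suc
            by (auto simp: a_def split: if_splits)
        qed (use BE cyc_a in auto)
        then show ?thesis using Suc by auto
      qed
      then obtain a' where a': "\<And>J. a' J \<noteq> 0 \<Longrightarrow> e \<notin> J \<and> insert e J \<in> M \<and> card J = n"
        and bd_a': "\<And>J. bdry E a' J = a J" by blast
      define b' where "b' J = b J + a' J" for J
      have b'D: "J \<in> D \<and> card J = n" if "b' J \<noteq> 0" for J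
      proof -
        have "b J \<noteq> 0 \<or> a' J \<noteq> 0" using that by (auto simp: b'_def)
        then show ?thesis using bD[of J] a'[of J] down by (auto simp: D_def)
      qed
      have cyc_b': "bdry E b' J = 0" for J
        unfolding b'_def by (simp add: bdry_add bd_b bd_a')
      \<comment> \<open>\<open>z\<close> differs from the boundary of the cone over \<open>a'\<close> by the cycle \<open>b'\<close>, which misses \<open>e\<close>\<close>
      have "\<exists>c. (\<forall>J. c J \<noteq> 0 \<longrightarrow> J \<in> M \<and> card J = Suc n) \<and> (\<forall>J. bdry E c J = b' J)"
      proof (cases "\<exists>I'\<in>D. n < card I'")
        case True
        then obtain I' where "I' \<in> D" "n < card I'" by blast
        then have "\<exists>c. (\<forall>J. c J \<noteq> 0 \<longrightarrow> J \<in> D \<and> card J = Suc n) \<and> (\<forall>J. bdry E c J = b' J)"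
          using BE mD b'D cyc_b' by (intro insert.IH[of D I' n b']) auto
        then show ?thesis by (auto simp: D_def)
      next
        case False
        have up: "insert e J \<in> M" if "J \<in> D" "card J = n" for J
        proof -
          have "card J < card I" "J \<in> M" using that insert.prems(4) by (auto simp: D_def)
          then obtain f where f: "f \<in> I - J" "insert f J \<in> M"
            using matroid_exchange[OF M, of J I] insert.prems(3) by blast
          then have "card (insert f J) = Suc n"
            using fin[OF \<open>J \<in> M\<close>] that(2) by simp
          then have "insert f J \<notin> D" using False by auto
          then have "f = e" using f that(1) by (auto simp: D_def)
          then show ?thesis using f(2) by simp
        qed
        have "J \<in> M \<and> card J = Suc n" if "cone_chain e b' J \<noteq> 0" for J
        proof -
          have J: "e \<in> J" "b' (J - {e}) \<noteq> 0"
            using that by (auto simp: cone_chain_def split: if_splits)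
          then have "insert e (J - {e}) \<in> M" "card (J - {e}) = n"
            using b'D up by blast+
          then show ?thesis
            using J(1) fin[of J] by (metis card.remove insert_Diff)
        qed
        moreover have "bdry E (cone_chain e b') J = b' J" for J
        proof -
          have avoid: "b' K = 0" if "e \<in> K" for K
            using b'D[of K] that unfolding D_def by blast
          then show ?thesis
            using bdry_cone_chain[of E e b' J] assms(1) eE cyc_b' by (cases "e \<in> J") auto
        qed
        ultimately show ?thesis by blast
      qed
      then obtain c where c: "\<And>J. c J \<noteq> 0 \<Longrightarrow> J \<in> M \<and> card J = Suc n"
        and bd_c: "\<And>J. bdry E c J = b' J" by blast
      show ?thesis
      proof (intro exI[of _ "\<lambda>J. c J + cone_chain e a' J"] conjI allI impI)
        fix J
        have "a' K = 0" if "e \<in> K" for K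
          using a'[of K] that by blast
        then have "bdry E (\<lambda>J. c J + cone_chain e a' J) J =
            b' J + (if e \<in> J then a (J - {e}) else a' J)"
          using bdry_cone_chain[of E e a' J] assms(1) eE
          by (simp add: bdry_add bd_c bd_a')
        also have "\<dots> = z J"
        proof (cases "e \<in> J")
          case True
          then have "a' J = 0" using a' by blast
          then show ?thesis using True by (auto simp: a_def b'_def b_def insert_absorb)
        next
          case False
          then show ?thesis by (simp add: b'_def b_def add.assoc)
        qed
        finally show "bdry E (\<lambda>J. c J + cone_chain e a' J) J = z J" .
      next
        fix J assume "c J + cone_chain e a' J \<noteq> 0"
        then have "c J \<noteq> 0 \<or> e \<in> J \<and> a' (J - {e}) \<noteq> 0"
          by (auto simp: cone_chain_def split: if_splits)
        then have "J \<in> M \<and> card J = Suc n"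
        proof
          assume J: "e \<in> J \<and> a' (J - {e}) \<noteq> 0"
          then have "J \<in> M" "card (J - {e}) = n"
            using a'[of "J - {e}"] by (auto simp: insert_absorb)
          then show ?thesis using J fin[of J] by (metis card.remove)
        qed (use c[of J] in blast)
        then show "J \<in> M" "card J = Suc n" by auto
      qed
    qed
  qed
qed

section \<open>The boundary of a cube as an antipodal sphere\<close>

text \<open>A cell of the cubical lattice of mesh 2 is coded by its centre \<open>c\<close>: at an even coordinate the cell
  is the single point \<open>c i\<close>, at an odd one it is the interval from \<open>c i - 1\<close> to \<open>c i + 1\<close>. The
  dimension is thus the number of odd coordinates, the antipode of a cell is \<open>- c\<close>, and passing to a facet
  moves one odd coordinate by \<open>1\<close> or \<open>-1\<close>.\<close>

definition odds :: "(nat \<Rightarrow> int) \<Rightarrow> nat set"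
  where "odds c = {i. odd (c i)}"

text \<open>These pairs index the facets of \<open>c\<close> without repetition.\<close>

definition flags :: "(nat \<Rightarrow> int) \<Rightarrow> (nat \<times> int) set"
  where "flags c = odds c \<times> {1, -1}"

abbreviation face :: "(nat \<Rightarrow> int) \<Rightarrow> nat \<times> int \<Rightarrow> nat \<Rightarrow> int"
  where "face c p \<equiv> c(fst p := c (fst p) + snd p)"

text \<open>The cells in the boundary of the cube of side \<open>2 N\<close> in dimension \<open>d + 1\<close>. Since \<open>N\<close> will be even, a coordinate of
  absolute value \<open>N\<close> is a single point, which puts the whole cell on a side of the cube.\<close>

definition sphere_cells :: "nat \<Rightarrow> int \<Rightarrow> (nat \<Rightarrow> int) set"
  where "sphere_cells d N = {c. (\<forall>i>d. c i = 0) \<and> (\<forall>i. \<bar>c i\<bar> \<le> N) \<and> (\<exists>i. \<bar>c i\<bar> = N)}"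

text \<open>The \<open>k\<close>-cells of the upper half of the sphere of dimension \<open>k\<close> spanned by the first \<open>k + 1\<close>
  coordinates. Together with \<open>disc N k\<close>, the equatorial disc, they enclose \<open>half_cube N k\<close>.\<close>

definition hemisphere :: "int \<Rightarrow> nat \<Rightarrow> (nat \<Rightarrow> int) set"
  where "hemisphere N k = {e. (\<forall>i>k. e i = 0) \<and> 0 < e k \<and>
    (\<exists>j\<le>k. \<bar>e j\<bar> = N \<and> (\<forall>i\<le>k. i \<noteq> j \<longrightarrow> odd (e i) \<and> \<bar>e i\<bar> < N))}"

definition disc :: "int \<Rightarrow> nat \<Rightarrow> (nat \<Rightarrow> int) set"
  where "disc N k = {e. (\<forall>i\<ge>k. e i = 0) \<and> (\<forall>i<k. odd (e i) \<and> \<bar>e i\<bar> < N)}"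

definition half_cube :: "int \<Rightarrow> nat \<Rightarrow> (nat \<Rightarrow> int) set"
  where "half_cube N k = {c. (\<forall>i>k. c i = 0) \<and> (\<forall>i\<le>k. odd (c i) \<and> \<bar>c i\<bar> < N) \<and> 0 < c k}"

lemma odd_coord_le: "\<forall>i>k. (c :: nat \<Rightarrow> int) i = 0 \<Longrightarrow> odd (c j) \<Longrightarrow> j \<le> k"
  by (metis even_zero linorder_not_le)

lemma finite_odds: "\<forall>i>k. c i = 0 \<Longrightarrow> finite (odds c)"
  by (rule finite_subset[of _ "{..k}"]) (auto simp: odds_def intro: odd_coord_le)

lemma finite_bounded_cells: "finite {c::nat \<Rightarrow> int. (\<forall>i>d. c i = 0) \<and> (\<forall>i. \<bar>c i\<bar> \<le> N)}"
proof (rule finite_subset)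
  show "{c::nat \<Rightarrow> int. (\<forall>i>d. c i = 0) \<and> (\<forall>i. \<bar>c i\<bar> \<le> N)} \<subseteq>
    {f. \<forall>i. (i \<in> {..d} \<longrightarrow> f i \<in> {-N..N}) \<and> (i \<notin> {..d} \<longrightarrow> f i = 0)}"
    by (auto simp: abs_le_iff) (smt (verit))+
  show "finite {f::nat \<Rightarrow> int. \<forall>i. (i \<in> {..d} \<longrightarrow> f i \<in> {-N..N}) \<and> (i \<notin> {..d} \<longrightarrow> f i = 0)}"
    by (rule finite_set_of_finite_funs) auto
qed

lemma finite_sphere_cells: "finite (sphere_cells d N)"
  unfolding sphere_cells_def by (rule finite_subset[OF _ finite_bounded_cells[of d N]]) auto

lemma hemisphere_subset: "0 < N \<Longrightarrow> k \<le> d \<Longrightarrow> hemisphere N k \<subseteq> sphere_cells d N"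
proof
  fix e assume N: "0 < N" "k \<le> d" and "e \<in> hemisphere N k"
  then obtain j where j: "\<bar>e j\<bar> = N" "\<And>i. i \<le> k \<Longrightarrow> i \<noteq> j \<Longrightarrow> \<bar>e i\<bar> < N" and zero: "\<And>i. i > k \<Longrightarrow> e i = 0"
    unfolding hemisphere_def by blast
  have "\<bar>e i\<bar> \<le> N" for i
    using j zero[of i] N(1) by (cases "i \<le> k"; cases "i = j") (auto simp: less_imp_le)
  then show "e \<in> sphere_cells d N"
    using j(1) zero N(2) by (auto simp: sphere_cells_def)
qed

lemma finite_hemisphere: "0 < N \<Longrightarrow> finite (hemisphere N k)"
  using hemisphere_subset[of N k k] finite_sphere_cells finite_subset by blast

lemma finite_half_cube: "finite (half_cube N k)"
proof (rule finite_subset[OF _ finite_bounded_cells[of k N]])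
  show "half_cube N k \<subseteq> {c. (\<forall>i>k. c i = 0) \<and> (\<forall>i. \<bar>c i\<bar> \<le> N)}"
    unfolding half_cube_def by auto (smt (verit) linorder_le_less_linear)
qed

lemma finite_disc: "0 < N \<Longrightarrow> finite (disc N k)"
proof (rule finite_subset[OF _ finite_bounded_cells[of k N]])
  show "0 < N \<Longrightarrow> disc N k \<subseteq> {c. (\<forall>i>k. c i = 0) \<and> (\<forall>i. \<bar>c i\<bar> \<le> N)}"
    unfolding disc_def by auto (smt (verit) linorder_le_less_linear)
qed

lemma odds_hemisphere:
  assumes "even N" "e \<in> hemisphere N k"
  shows "card (odds e) = k"
proof -
  obtain j where j: "j \<le> k" "\<bar>e j\<bar> = N" "\<And>i. i \<le> k \<Longrightarrow> i \<noteq> j \<Longrightarrow> odd (e i)"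
    and zero: "\<And>i. k < i \<Longrightarrow> e i = 0"
    using assms(2) unfolding hemisphere_def by blast
  have "even (e j)" using j(2) assms(1) by (metis dvd_abs_iff)
  then have "odds e = {..k} - {j}"
    unfolding odds_def using j(3) zero by (auto simp: not_le) (metis even_zero linorder_not_le)
  then show ?thesis using j(1) by simp
qed

lemma finite_odds_sphere_cells: "c \<in> sphere_cells d N \<Longrightarrow> finite (odds c)"
  by (rule finite_odds[of d]) (simp add: sphere_cells_def)

lemma finite_flags: "finite (odds c) \<Longrightarrow> finite (flags c)"
  by (simp add: flags_def)

lemma odds_face: "p \<in> flags c \<Longrightarrow> odds (face c p) = odds c - {fst p}"
  by (auto simp: flags_def odds_def)

lemma face_in_sphere_cells:
  assumes "even N" "c \<in> sphere_cells d N" "p \<in> flags c"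
  shows "face c p \<in> sphere_cells d N"
proof -
  obtain j s where p: "p = (j, s)" "odd (c j)" "s = 1 \<or> s = -1"
    using assms(3) by (auto simp: flags_def odds_def)
  obtain i where i: "\<bar>c i\<bar> = N" using assms(2) by (auto simp: sphere_cells_def)
  have "even (c i)" using i assms(1) by (metis dvd_abs_iff)
  then have "i \<noteq> j" using p(2) by auto
  have "\<bar>c j\<bar> \<le> N" using assms(2) by (auto simp: sphere_cells_def)
  moreover have "\<bar>c j\<bar> \<noteq> N" using p(2) assms(1) by (metis dvd_abs_iff)
  ultimately have "\<bar>c j + s\<bar> \<le> N" using p(3) by auto
  moreover have "j \<le> d" using assms(2) p(2) unfolding sphere_cells_def
    by (metis (mono_tags, lifting) even_zero linorder_not_le mem_Collect_eq)
  ultimately show ?thesis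
    using assms(2) i \<open>i \<noteq> j\<close> unfolding sphere_cells_def p(1) by auto
qed

lemma uminus_in_sphere_cells: "- c \<in> sphere_cells d N \<longleftrightarrow> c \<in> sphere_cells d N"
  by (simp add: sphere_cells_def)

lemma odds_uminus [simp]: "odds (- c) = odds c"
  by (simp add: odds_def)

lemma sum_flags_uminus:
  "(\<Sum>p\<in>flags (- c). f (face (- c) p)) = (\<Sum>p\<in>flags c. f (- face c p))"
  by (rule sum.reindex_bij_witness[of _ "\<lambda>p. (fst p, - snd p)" "\<lambda>p. (fst p, - snd p)"])
     (auto simp: flags_def intro!: arg_cong[where f=f])

text \<open>A face of codimension two is reached by changing two odd coordinates, in either order.\<close>

lemma faces_of_faces_cancel:
  fixes f :: "(nat \<Rightarrow> int) \<Rightarrow> bit"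
  assumes "finite (odds c)"
  shows "(\<Sum>p\<in>flags c. \<Sum>q\<in>flags (face c p). f (face (face c p) q)) = 0"
proof -
  have "(\<Sum>p\<in>flags c. \<Sum>q\<in>flags (face c p). f (face (face c p) q)) =
    (\<Sum>(p, q)\<in>(SIGMA p:flags c. flags (face c p)). f (face (face c p) q))"
    using assms by (intro sum.Sigma) (simp_all add: finite_flags odds_face)
  also have "\<dots> = 0"
  proof (rule bit_sum_involution[where \<tau> = "\<lambda>(p, q). (q, p)"])
    show "finite (SIGMA p:flags c. flags (face c p))"
      using assms by (intro finite_SigmaI) (simp_all add: finite_flags odds_face)
  qed (auto simp: flags_def odds_def fun_upd_twist split: if_splits)
  finally show ?thesis .
qed

text \<open>Moving coordinate \<open>j\<close> from \<open>c j\<close> to \<open>c j + s\<close> gives the same facet as moving it back from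
  \<open>c j + 2 s\<close>. This pairs off all flags except those whose facet lies on the outer surface or on the
  equator, where the second cell falls outside of the half cube.\<close>

lemma boundary_half_cube:
  fixes f :: "(nat \<Rightarrow> int) \<Rightarrow> bit"
  assumes N: "even N" "0 < N"
  shows "(\<Sum>c\<in>half_cube N k. \<Sum>p\<in>flags c. f (face c p)) = sum f (hemisphere N k) + sum f (disc N k)"
proof -
  define F where "F = (SIGMA c:half_cube N k. flags c)"
  define G where "G = {x\<in>F. face (fst x) (snd x) \<in> hemisphere N k \<union> disc N k}"
  define g where "g x = f (face (fst x) (snd x))" for x
  have mem: "(c, j, s) \<in> F \<longleftrightarrow> c \<in> half_cube N k \<and> j \<le> k \<and> (s = 1 \<or> s = -1)" for c j s
    unfolding F_def flags_def odds_def half_cube_def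
    by (auto intro: odd_coord_le)
  have fl: "finite (flags c)" if "c \<in> half_cube N k" for c
    using that finite_odds[of k c] by (simp add: finite_flags half_cube_def)
  have fin: "finite F"
    unfolding F_def using finite_half_cube fl by (rule finite_SigmaI)
  have "(\<Sum>c\<in>half_cube N k. \<Sum>p\<in>flags c. f (face c p)) = sum g F"
    unfolding F_def g_def using finite_half_cube fl
    by (subst sum.Sigma) (simp_all add: case_prod_unfold)
  also have "\<dots> = sum g (F - G) + sum g G"
    using fin by (intro sum.subset_diff) (auto simp: G_def)
  also have "sum g (F - G) = 0"
  proof (rule bit_sum_involution[where \<tau> = "\<lambda>(c, j, s). (c(j := c j + 2 * s), j, - s)"])
    fix x assume "x \<in> F - G"
    then obtain c j s where x: "x = (c, j, s)" "(c, j, s) \<in> F" "(c, j, s) \<notin> G"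
      by (cases x) auto
    have c: "\<And>i. i > k \<Longrightarrow> c i = 0" "\<And>i. i \<le> k \<Longrightarrow> odd (c i)" "\<And>i. i \<le> k \<Longrightarrow> \<bar>c i\<bar> < N" "0 < c k"
      and j: "j \<le> k" and s: "s = 1 \<or> s = -1"
      using x(2) unfolding mem half_cube_def by auto
    have "c j + s \<noteq> N \<and> c j + s \<noteq> - N"
    proof (rule ccontr)
      assume "\<not> ?thesis"
      then have *: "\<bar>(face c (j, s)) j\<bar> = N" using N(2) by auto
      have "0 < (face c (j, s)) k"
        using c(2)[of k] c(4) s * N(2) by auto
      then have "face c (j, s) \<in> hemisphere N k"
        using * c j unfolding hemisphere_def by (auto intro!: exI[of _ j])
      then show False using x(2,3) by (simp add: G_def)
    qed
    moreover have "\<bar>c j\<bar> < N" "odd (c j)" using c j by auto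
    moreover obtain n q where "N = 2 * n" "c j = 2 * q + 1"
      using N(1) \<open>odd (c j)\<close> by (elim evenE oddE)
    ultimately have small: "\<bar>c j + 2 * s\<bar> < N"
      using s by (elim disjE) arith+
    have "0 < (c(j := c j + 2 * s)) k"
    proof (cases "j = k")
      case True
      have "c k + s \<noteq> 0"
      proof
        assume "c k + s = 0"
        then have "face c (j, s) \<in> disc N k"
          using c True unfolding disc_def by (auto simp: less_imp_le)
        then show False using x(2,3) by (simp add: G_def)
      qed
      then show ?thesis using True c(2)[of k] c(4) s by auto presburger
    qed (use c in simp)
    then have "(c(j := c j + 2 * s), j, - s) \<in> F"
      unfolding mem half_cube_def using c j s small by auto
    then show "(\<lambda>(c, j, s). (c(j := c j + 2 * s), j, - s)) x \<in> F - G"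
      using x(2,3) by (auto simp: G_def x(1) algebra_simps)
  next
    fix x assume "x \<in> F - G"
    then obtain c j s where x: "x = (c, j, s)" "(c, j, s) \<in> F"
      by (cases x) auto
    have s: "s = 1 \<or> s = -1" using x(2) unfolding mem by blast
    show "(\<lambda>(c, j, s). (c(j := c j + 2 * s), j, - s)) ((\<lambda>(c, j, s). (c(j := c j + 2 * s), j, - s)) x) = x"
      "(\<lambda>(c, j, s). (c(j := c j + 2 * s), j, - s)) x \<noteq> x"
      "g ((\<lambda>(c, j, s). (c(j := c j + 2 * s), j, - s)) x) = g x"
      using s by (auto simp: x(1) g_def add.commute)
  qed (use fin in simp)
  also have "sum g G = sum f (hemisphere N k \<union> disc N k)"
  proof (rule sum.reindex_bij_betw[where h = "\<lambda>x. face (fst x) (snd x)" and g = f, folded g_def])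
    show "bij_betw (\<lambda>x. face (fst x) (snd x)) G (hemisphere N k \<union> disc N k)"
    proof (rule bij_betw_imageI)
      show "inj_on (\<lambda>x. face (fst x) (snd x)) G"
      proof (rule inj_onI)
        fix x x' assume xs: "x \<in> G" "x' \<in> G" and eq: "face (fst x) (snd x) = face (fst x') (snd x')"
        obtain c j s where x: "x = (c, j, s)" by (cases x) auto
        obtain c' j' s' where x': "x' = (c', j', s')" by (cases x') auto
        have F: "(c, j, s) \<in> F" "(c', j', s') \<in> F" using xs by (auto simp: G_def x x')
        then have c: "\<And>i. i \<le> k \<Longrightarrow> odd (c i)" "\<And>i. i \<le> k \<Longrightarrow> odd (c' i)"
          and j: "j \<le> k" "j' \<le> k" and s: "s = 1 \<or> s = -1" "s' = 1 \<or> s' = -1"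
          and bd: "\<bar>c j\<bar> < N" "\<bar>c' j'\<bar> < N" and pos: "0 < c k" "0 < c' k"
          unfolding mem half_cube_def by auto
        have e: "c(j := c j + s) = c'(j' := c' j' + s')" using eq by (simp add: x x')
        have "j = j'"
        proof (rule ccontr)
          assume "j \<noteq> j'"
          then have "c' j = c j + s" using fun_cong[OF e, of j] by simp
          then show False using c(1)[OF j(1)] c(2)[OF j(1)] s by auto
        qed
        moreover have val: "c j + s = c' j + s'" using fun_cong[OF e, of j] \<open>j = j'\<close> by simp
        moreover have "c i = c' i" if "i \<noteq> j" for i
          using fun_cong[OF e, of i] that \<open>j = j'\<close> by simp
        moreover have ss: "s = s'"
        proof (rule ccontr)
          assume "s \<noteq> s'"
          have "face c (j, s) \<in> hemisphere N k \<union> disc N k" using xs by (simp add: G_def x)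
          then have "\<bar>c j + s\<bar> = N \<or> (j = k \<and> c j + s = 0)"
          proof
            assume "face c (j, s) \<in> hemisphere N k"
            then obtain i where i: "i \<le> k" "\<bar>(face c (j, s)) i\<bar> = N"
              unfolding hemisphere_def by blast
            have "even ((face c (j, s)) i)" using i(2) N(1) by (metis dvd_abs_iff)
            then have "i = j" using c(1)[OF i(1)] by (auto split: if_splits)
            then show ?thesis using i(2) by simp
          next
            assume "face c (j, s) \<in> disc N k"
            then have z: "(face c (j, s)) k = 0" by (auto simp: disc_def)
            moreover have "j = k"
              using z c(1)[of k] by (cases "j = k") auto
            ultimately show ?thesis by simp
          qed
          then show False using val bd pos s \<open>s \<noteq> s'\<close> \<open>j = j'\<close> by auto
        qed
        ultimately have "c i = c' i" for i by (cases "i = j") auto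
        then show "x = x'" using \<open>j = j'\<close> ss unfolding x x' by auto
      qed
      show "(\<lambda>x. face (fst x) (snd x)) ` G = hemisphere N k \<union> disc N k"
      proof (intro equalityI subsetI)
        fix e assume e: "e \<in> hemisphere N k \<union> disc N k"
        have "\<exists>c j s. (c, j, s) \<in> F \<and> face c (j, s) = e"
        proof (cases "e \<in> disc N k")
          case True
          then have "(e(k := 1), k, -1) \<in> F"
            unfolding mem half_cube_def disc_def using N
            by (auto simp: order_le_less)
          moreover have "face (e(k := 1)) (k, -1) = e"
            using True by (auto simp: disc_def)
          ultimately show ?thesis by blast
        next
          case False
          then have "e \<in> hemisphere N k" using e by blast
          then obtain j where j: "j \<le> k" "\<bar>e j\<bar> = N"
            "\<And>i. i \<le> k \<Longrightarrow> i \<noteq> j \<Longrightarrow> odd (e i) \<and> \<bar>e i\<bar> < N"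
            and zero: "\<And>i. k < i \<Longrightarrow> e i = 0" and pos: "0 < e k"
            unfolding hemisphere_def by blast
          have ej: "even (e j)" using j(2) N(1) by (metis dvd_abs_iff)
          have s: "sgn (e j) = 1 \<or> sgn (e j) = -1" using j(2) N(2) by (auto simp: sgn_if)
          have "(e(j := e j - sgn (e j)), j, sgn (e j)) \<in> F"
            unfolding mem half_cube_def using j zero pos s ej N
            by (auto simp: sgn_if split: if_splits)
          moreover have "face (e(j := e j - sgn (e j))) (j, sgn (e j)) = e" by simp
          ultimately show ?thesis by blast
        qed
        then obtain c j s where "(c, j, s) \<in> F" "face c (j, s) = e" by blast
        then show "e \<in> (\<lambda>x. face (fst x) (snd x)) ` G"
          using e by (intro image_eqI[of _ _ "(c, j, s)"]) (auto simp: G_def)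
      qed (auto simp: G_def)
    qed
  qed
  also have "\<dots> = sum f (hemisphere N k) + sum f (disc N k)"
    using finite_hemisphere[OF N(2)] finite_disc[OF N(2)]
    by (intro sum.union_disjoint) (auto simp: hemisphere_def disc_def)
  finally show ?thesis by (simp only: add_0_left)
qed

lemma disc_Suc: "0 < N \<Longrightarrow> disc N (Suc k) = half_cube N k \<union> uminus ` half_cube N k"
proof (intro equalityI subsetI)
  fix e assume e: "e \<in> disc N (Suc k)"
  then have "odd (e k)" by (simp add: disc_def)
  then have "e k \<noteq> 0" by auto
  then have "e \<in> half_cube N k \<or> - e \<in> half_cube N k"
    using e by (auto simp: disc_def half_cube_def)
  then show "e \<in> half_cube N k \<union> uminus ` half_cube N k"
    by (metis UnCI add.inverse_inverse image_eqI)
qed (auto simp: disc_def half_cube_def)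

text \<open>The hemisphere has the same boundary as \<open>disc N (k + 1)\<close>, because together they bound a half cube
  and boundaries have no boundary. This disc is the union of \<open>half_cube N k\<close> and its antipode, so its boundary is
  \<open>hemisphere N k\<close> plus its antipode, while the copies of the symmetric set \<open>disc N k\<close> cancel.\<close>

lemma boundary_hemisphere:
  fixes f :: "(nat \<Rightarrow> int) \<Rightarrow> bit"
  assumes N: "even N" "0 < N"
  shows "(\<Sum>c\<in>hemisphere N (Suc k). \<Sum>p\<in>flags c. f (face c p)) =
    (\<Sum>e\<in>hemisphere N k. f e + f (- e))"
proof -
  have disc: "(\<Sum>e\<in>disc N k. f (- e)) = sum f (disc N k)"
    by (rule sum.reindex_bij_witness[of _ uminus uminus]) (auto simp: disc_def)
  have four: "a + b + (c + b) = a + c" for a b c :: bit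
    by (cases a; cases b; cases c) simp_all
  define g where "g c = (\<Sum>p\<in>flags c. f (face c p))" for c
  have "(\<Sum>c\<in>half_cube N (Suc k). \<Sum>p\<in>flags c. g (face c p)) = 0"
  proof (rule sum.neutral, rule ballI)
    fix c assume "c \<in> half_cube N (Suc k)"
    then have "finite (odds c)"
      by (intro finite_odds[of "Suc k"]) (simp add: half_cube_def)
    then show "(\<Sum>p\<in>flags c. g (face c p)) = 0"
      unfolding g_def by (rule faces_of_faces_cancel)
  qed
  then have "sum g (hemisphere N (Suc k)) = sum g (disc N (Suc k))"
    using boundary_half_cube[OF N, of g "Suc k"] by (simp add: bit_add_eq_0_iff)
  also have "\<dots> = sum g (half_cube N k) + sum g (uminus ` half_cube N k)"
    unfolding disc_Suc[OF N(2)] using finite_half_cube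
    by (intro sum.union_disjoint) (auto simp: half_cube_def)
  also have "sum g (uminus ` half_cube N k) = (\<Sum>c\<in>half_cube N k. g (- c))"
    by (subst sum.reindex) (auto intro!: inj_onI)
  also have "(\<Sum>c\<in>half_cube N k. g (- c)) = (\<Sum>c\<in>half_cube N k. \<Sum>p\<in>flags c. f (- face c p))"
    unfolding g_def by (intro sum.cong refl sum_flags_uminus)
  also have "sum g (half_cube N k) + \<dots> =
      (sum f (hemisphere N k) + sum f (disc N k)) +
      ((\<Sum>e\<in>hemisphere N k. f (- e)) + (\<Sum>e\<in>disc N k. f (- e)))"
    using boundary_half_cube[OF N, of f k] boundary_half_cube[OF N, of "\<lambda>e. f (- e)" k]
    by (simp add: g_def)
  also have "\<dots> = sum f (hemisphere N k) + (\<Sum>e\<in>hemisphere N k. f (- e))"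
    using four by (simp add: disc)
  finally show ?thesis
    unfolding g_def sum.distrib .
qed

section \<open>Cones spanned by vectors in general position\<close>

text \<open>Gaussian elimination of one equation at a time, with one pivot unknown each.\<close>

lemma nontrivial_solution:
  fixes c :: "'a \<Rightarrow> 'b \<Rightarrow> real"
  assumes "finite Q" "finite I" "card Q < card I"
  shows "\<exists>l. (\<exists>v\<in>I. l v \<noteq> 0) \<and> (\<forall>q\<in>Q. (\<Sum>v\<in>I. l v * c v q) = 0)"
  using assms
proof (induction Q arbitrary: I c)
  case empty
  then have "I \<noteq> {}" by auto
  then show ?case by (intro exI[of _ "\<lambda>_. 1"]) auto
next
  case (insert q Q)
  show ?case
  proof (cases "\<forall>v\<in>I. c v q = 0")
    case True
    have "card Q < card I" using insert by simp
    then show ?thesis using insert.IH[OF insert.prems(1), of c] True by auto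
  next
    case False
    then obtain u where u: "u \<in> I" "c u q \<noteq> 0" by blast
    define c' where "c' v p = c v p - c v q / c u q * c u p" for v p
    have "card Q < card (I - {u})" using insert.prems insert.hyps u(1) by simp
    then obtain l where l: "\<exists>v\<in>I - {u}. l v \<noteq> 0" "\<forall>p\<in>Q. (\<Sum>v\<in>I - {u}. l v * c' v p) = 0"
      using insert.IH[of "I - {u}" c'] insert.prems(1) by blast
    define t where "t = - (\<Sum>v\<in>I - {u}. l v * c v q) / c u q"
    define m where "m = l(u := t)"
    have sum_m: "(\<Sum>v\<in>I. m v * c v p) = t * c u p + (\<Sum>v\<in>I - {u}. l v * c v p)" for p
      using insert.prems(1) u(1) unfolding m_def by (simp add: sum.remove)
    have "(\<Sum>v\<in>I. m v * c v q) = 0"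
      unfolding sum_m t_def using u(2) by simp
    moreover have "(\<Sum>v\<in>I. m v * c v p) = 0" if "p \<in> Q" for p
    proof -
      have "(\<Sum>v\<in>I - {u}. l v * c v p) - (\<Sum>v\<in>I - {u}. l v * c v q) / c u q * c u p = 0"
        using l(2) that unfolding c'_def
        by (simp add: right_diff_distrib sum_subtractf sum_distrib_right sum_divide_distrib mult.assoc)
      then show ?thesis unfolding sum_m t_def by simp
    qed
    moreover have "\<exists>v\<in>I. m v \<noteq> 0" using l(1) by (auto simp: m_def)
    ultimately show ?thesis by blast
  qed
qed

text \<open>Every set \<open>S\<close> of \<open>n\<close> vectors of the family is to be independent already in its first \<open>n\<close>
  coordinates. This is more than linear independence of small subsets: it also makes the flag of
  coordinate subspaces generic for the family.\<close>

definition general_position :: "('a \<Rightarrow> nat \<Rightarrow> real) \<Rightarrow> 'a set \<Rightarrow> bool"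
  where "general_position y T \<longleftrightarrow> (\<forall>S\<subseteq>T. \<forall>l.
    (\<forall>a<card S. (\<Sum>v\<in>S. l v * y v a) = 0) \<longrightarrow> (\<forall>v\<in>S. l v = 0))"

text \<open>Choose the vectors one after another. A set \<open>S\<close> of earlier vectors spans, in the first
  \<open>card S + 1\<close> coordinates, at most a hyperplane, and the next vector has to avoid finitely many of
  these. Moving it along the curve of powers of \<open>\<epsilon>\<close> meets each hyperplane only in the roots of a nonzero polynomial.\<close>

lemma general_position_perturb:
  fixes y :: "'a \<Rightarrow> nat \<Rightarrow> real"
  assumes "finite T" "0 < \<delta>"
  shows "\<exists>y'. (\<forall>v\<in>T. \<forall>a. \<bar>y' v a - y v a\<bar> \<le> \<delta>) \<and> general_position y' T"
  using assms(1)
proof (induction T)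
  case empty
  then show ?case by (auto simp: general_position_def)
next
  case (insert p T)
  then obtain y' where close: "\<forall>v\<in>T. \<forall>a. \<bar>y' v a - y v a\<bar> \<le> \<delta>" and gp: "general_position y' T"
    by blast
  \<comment> \<open>a hyperplane, in the first \<open>card S + 1\<close> coordinates, through the points of \<open>S\<close>\<close>
  have "\<exists>c. \<forall>S\<in>Pow T. (\<exists>a\<in>{..card S}. c S a \<noteq> 0) \<and> (\<forall>v\<in>S. (\<Sum>a\<le>card S. c S a * y' v a) = 0)"
  proof (rule bchoice, rule ballI)
    fix S assume "S \<in> Pow T"
    then have "finite S" using insert.hyps(1) finite_subset by blast
    then show "\<exists>l. (\<exists>a\<in>{..card S}. l a \<noteq> 0) \<and> (\<forall>v\<in>S. (\<Sum>a\<le>card S. l a * y' v a) = 0)"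
      by (intro nontrivial_solution) auto
  qed
  then obtain c where c: "\<And>S. S \<subseteq> T \<Longrightarrow> \<exists>a\<in>{..card S}. c S a \<noteq> 0"
    "\<And>S v. S \<subseteq> T \<Longrightarrow> v \<in> S \<Longrightarrow> (\<Sum>a\<le>card S. c S a * y' v a) = 0" by auto
  have fin_bad: "finite {e::real. (\<Sum>a\<le>card S. c S a * (y p a + e ^ Suc a)) = 0}" if ST: "S \<subseteq> T" for S
  proof -
    define b where "b i = (if i = 0 then \<Sum>a\<le>card S. c S a * y p a else c S (i - 1))" for i
    have "(\<Sum>a\<le>card S. c S a * (y p a + e ^ Suc a)) = (\<Sum>i\<le>Suc (card S). b i * e ^ i)" for e
      unfolding b_def by (subst sum.atMost_Suc_shift) (simp add: distrib_left sum.distrib)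
    moreover have "\<exists>i\<le>Suc (card S). b i \<noteq> 0"
    proof -
      obtain a where "a \<le> card S" "c S a \<noteq> 0" using c(1)[OF ST] by auto
      then show ?thesis by (intro exI[of _ "Suc a"]) (simp add: b_def)
    qed
    ultimately show ?thesis using polyfun_finite_roots[of b "Suc (card S)"] by simp
  qed
  define \<epsilon>\<^sub>0 where "\<epsilon>\<^sub>0 = min 1 \<delta>"
  have "infinite ({0<..<\<epsilon>\<^sub>0} - (\<Union>S\<in>Pow T. {e. (\<Sum>a\<le>card S. c S a * (y p a + e ^ Suc a)) = 0}))"
    using fin_bad insert.hyps(1) \<open>0 < \<delta>\<close>
    by (intro Diff_infinite_finite finite_UN_I) (auto simp: \<epsilon>\<^sub>0_def)
  then have "{0<..<\<epsilon>\<^sub>0} - (\<Union>S\<in>Pow T. {e. (\<Sum>a\<le>card S. c S a * (y p a + e ^ Suc a)) = 0}) \<noteq> {}"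
    by (rule infinite_imp_nonempty)
  then obtain \<epsilon> where \<epsilon>_in: "\<epsilon> \<in> {0<..<\<epsilon>\<^sub>0} - (\<Union>S\<in>Pow T. {e. (\<Sum>a\<le>card S. c S a * (y p a + e ^ Suc a)) = 0})"
    by (meson ex_in_conv)
  have \<epsilon>: "0 < \<epsilon>" "\<epsilon> < \<epsilon>\<^sub>0" using \<epsilon>_in by simp_all
  have avoid: "(\<Sum>a\<le>card S. c S a * (y p a + \<epsilon> ^ Suc a)) \<noteq> 0" if "S \<subseteq> T" for S
    using \<epsilon>_in that by (simp del: power_Suc)
  define z where "z = y'(p := \<lambda>a. y p a + \<epsilon> ^ Suc a)"
  have z: "z v = y' v" if "v \<in> T" for v using that insert.hyps(2) by (auto simp: z_def)
  have "\<bar>z v a - y v a\<bar> \<le> \<delta>" if "v \<in> insert p T" for v a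
  proof (cases "v = p")
    case True
    have "\<epsilon> ^ Suc a \<le> \<epsilon> ^ 1" using \<epsilon>(1,2) by (intro power_decreasing) (auto simp: \<epsilon>\<^sub>0_def)
    then show ?thesis using \<epsilon>(1,2) True by (auto simp: z_def \<epsilon>\<^sub>0_def simp del: power_Suc)
  qed (use that close z in auto)
  moreover have "general_position z (insert p T)"
    unfolding general_position_def
  proof (intro allI impI)
    fix S l assume S: "S \<subseteq> insert p T" and l: "\<forall>a<card S. (\<Sum>v\<in>S. l v * z v a) = 0"
    have finS: "finite S" using S insert.hyps(1) finite_subset by blast
    show "\<forall>v\<in>S. l v = 0"
    proof (cases "p \<in> S")
      case False
      then have ST: "S \<subseteq> T" using S by blast
      then have "(\<Sum>v\<in>S. l v * y' v a) = (\<Sum>v\<in>S. l v * z v a)" for a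
        using z by (intro sum.cong) auto
      then show ?thesis using gp ST l unfolding general_position_def by auto
    next
      case True
      define R where "R = S - {p}"
      have R: "R \<subseteq> T" "card S = Suc (card R)"
        using S card.remove[OF finS True] by (auto simp: R_def)
      have sumS: "(\<Sum>v\<in>S. l v * z v a) = l p * z p a + (\<Sum>v\<in>R. l v * y' v a)" for a
      proof -
        have "(\<Sum>v\<in>S. l v * z v a) = l p * z p a + (\<Sum>v\<in>R. l v * z v a)"
          using True finS by (simp add: R_def sum.remove)
        also have "(\<Sum>v\<in>R. l v * z v a) = (\<Sum>v\<in>R. l v * y' v a)"
          using R(1) z by (intro sum.cong) auto
        finally show ?thesis .
      qed
      have "0 = (\<Sum>a\<le>card R. c R a * (l p * z p a + (\<Sum>v\<in>R. l v * y' v a)))"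
        using l R(2) unfolding sumS by (intro sum.neutral[symmetric]) auto
      also have "\<dots> = l p * (\<Sum>a\<le>card R. c R a * z p a) +
          (\<Sum>a\<le>card R. \<Sum>v\<in>R. l v * (c R a * y' v a))"
        by (simp add: distrib_left sum.distrib sum_distrib_left mult.left_commute)
      also have "(\<Sum>a\<le>card R. \<Sum>v\<in>R. l v * (c R a * y' v a)) =
          (\<Sum>v\<in>R. l v * (\<Sum>a\<le>card R. c R a * y' v a))"
        by (subst sum.swap) (simp add: sum_distrib_left)
      also have "\<dots> = 0" using c(2)[OF R(1)] by simp
      finally have "l p = 0" using avoid[OF R(1)] by (simp add: z_def)
      moreover from this have "\<forall>a<card R. (\<Sum>v\<in>R. l v * y' v a) = 0"
        using l R(2) unfolding sumS by simp
      then have "\<forall>v\<in>R. l v = 0"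
        using gp[unfolded general_position_def, rule_format, OF R(1), of l] by simp
      ultimately show ?thesis by (auto simp: R_def)
    qed
  qed
  ultimately show ?case by blast
qed

text \<open>The test that the parity argument applies to the \<open>k\<close>-simplices: whether their cone meets an open
  half of the subspace where the first \<open>k\<close> coordinates vanish.\<close>

definition hits_halfspace :: "('a \<Rightarrow> nat \<Rightarrow> real) \<Rightarrow> nat \<Rightarrow> 'a set \<Rightarrow> bool"
  where "hits_halfspace y k J \<longleftrightarrow> (\<exists>l. (\<forall>v\<in>J. 0 \<le> l v) \<and>
    (\<forall>a<k. (\<Sum>v\<in>J. l v * y v a) = 0) \<and> 0 < (\<Sum>v\<in>J. l v * y v k))"

definition hits_subspace :: "('a \<Rightarrow> nat \<Rightarrow> real) \<Rightarrow> nat \<Rightarrow> 'a set \<Rightarrow> bool"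
  where "hits_subspace y k J \<longleftrightarrow> (\<exists>l. (\<forall>v\<in>J. 0 \<le> l v) \<and> (\<exists>v\<in>J. l v \<noteq> 0) \<and>
    (\<forall>a<k. (\<Sum>v\<in>J. l v * y v a) = 0))"

lemma general_positionD:
  assumes "general_position y T" "S \<subseteq> T" "card S = n" "\<And>a. a < n \<Longrightarrow> (\<Sum>v\<in>S. l v * y v a) = 0" "v \<in> S"
  shows "l v = 0"
proof -
  have "\<forall>a<card S. (\<Sum>v\<in>S. l v * y v a) = 0" using assms(3,4) by simp
  then have "\<forall>v\<in>S. l v = 0"
    using assms(1)[unfolded general_position_def, rule_format, OF assms(2), of l] by simp
  then show ?thesis using assms(5) by blast
qed

text \<open>The nonnegative combinations that vanish in the first \<open>k\<close> coordinates form at most a single ray,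
  on which coordinate \<open>k\<close> does not vanish.\<close>

lemma hits_subspace_split:
  assumes gp: "general_position y T" and card: "card T = Suc k"
  shows "hits_subspace y k T \<longleftrightarrow> hits_halfspace y k T \<noteq> hits_halfspace (\<lambda>v a. - y v a) k T"
proof
  assume "hits_subspace y k T"
  then obtain l where l: "\<forall>v\<in>T. 0 \<le> l v" "\<exists>v\<in>T. l v \<noteq> 0" "\<forall>a<k. (\<Sum>v\<in>T. l v * y v a) = 0"
    unfolding hits_subspace_def by blast
  have "(\<Sum>v\<in>T. l v * y v k) \<noteq> 0"
  proof
    assume "(\<Sum>v\<in>T. l v * y v k) = 0"
    then have "(\<Sum>v\<in>T. l v * y v a) = 0" if "a < Suc k" for a
      using that l(3) less_Suc_eq by auto
    then show False using general_positionD[OF gp subset_refl card] l(2) by blast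
  qed
  then have "0 < (\<Sum>v\<in>T. l v * y v k) \<or> 0 < (\<Sum>v\<in>T. l v * (- y v k))"
    by (auto simp: sum_negf)
  then have "hits_halfspace y k T \<or> hits_halfspace (\<lambda>v a. - y v a) k T"
  proof
    assume "0 < (\<Sum>v\<in>T. l v * y v k)"
    then show ?thesis
      unfolding hits_halfspace_def using l by (intro disjI1 exI[of _ l]) simp
  next
    assume "0 < (\<Sum>v\<in>T. l v * (- y v k))"
    then show ?thesis
      unfolding hits_halfspace_def using l by (intro disjI2 exI[of _ l]) (simp add: sum_negf)
  qed
  moreover have "\<not> (hits_halfspace y k T \<and> hits_halfspace (\<lambda>v a. - y v a) k T)"
  proof
    assume "hits_halfspace y k T \<and> hits_halfspace (\<lambda>v a. - y v a) k T"
    then obtain l m where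
      l: "\<forall>v\<in>T. 0 \<le> l v" "\<forall>a<k. (\<Sum>v\<in>T. l v * y v a) = 0" "0 < (\<Sum>v\<in>T. l v * y v k)" and
      m: "\<forall>v\<in>T. 0 \<le> m v" "\<forall>a<k. (\<Sum>v\<in>T. m v * y v a) = 0" "0 > (\<Sum>v\<in>T. m v * y v k)"
      unfolding hits_halfspace_def by (auto simp: sum_negf)
    define \<alpha> \<beta> where "\<alpha> = (\<Sum>v\<in>T. l v * y v k)" and "\<beta> = - (\<Sum>v\<in>T. m v * y v k)"
    have pos: "0 < \<alpha>" "0 < \<beta>" using l(3) m(3) by (auto simp: \<alpha>_def \<beta>_def)
    have comb: "(\<Sum>v\<in>T. (\<beta> * l v + \<alpha> * m v) * y v a) =
        \<beta> * (\<Sum>v\<in>T. l v * y v a) + \<alpha> * (\<Sum>v\<in>T. m v * y v a)" for a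
      by (simp add: distrib_right sum.distrib sum_distrib_left mult.assoc)
    have "(\<Sum>v\<in>T. (\<beta> * l v + \<alpha> * m v) * y v a) = 0" if "a < Suc k" for a
      using that l(2) m(2) unfolding comb by (auto simp: less_Suc_eq \<alpha>_def \<beta>_def)
    then have "\<beta> * l v + \<alpha> * m v = 0" if "v \<in> T" for v
      using general_positionD[OF gp subset_refl card, of "\<lambda>v. \<beta> * l v + \<alpha> * m v"] that by blast
    then have "l v = 0" if "v \<in> T" for v
      using that l(1) m(1) pos
      by (metis add_nonneg_eq_0_iff less_imp_le mult_eq_0_iff mult_nonneg_nonneg order_less_irrefl)
    then show False using l(3) by simp
  qed
  ultimately show "hits_halfspace y k T \<noteq> hits_halfspace (\<lambda>v a. - y v a) k T" by blast
next
  assume "hits_halfspace y k T \<noteq> hits_halfspace (\<lambda>v a. - y v a) k T"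
  then have "\<exists>l. (\<forall>v\<in>T. 0 \<le> l v) \<and> (\<forall>a<k. (\<Sum>v\<in>T. l v * y v a) = 0) \<and> (\<Sum>v\<in>T. l v * y v k) \<noteq> 0"
  proof (cases "hits_halfspace y k T")
    case True
    then show ?thesis unfolding hits_halfspace_def by (metis order_less_irrefl)
  next
    case False
    then have "hits_halfspace (\<lambda>v a. - y v a) k T"
      using \<open>hits_halfspace y k T \<noteq> hits_halfspace (\<lambda>v a. - y v a) k T\<close> by simp
    then obtain l where "\<forall>v\<in>T. 0 \<le> l v" "\<forall>a<k. (\<Sum>v\<in>T. l v * - y v a) = 0" "0 < (\<Sum>v\<in>T. l v * - y v k)"
      unfolding hits_halfspace_def by blast
    then show ?thesis by (intro exI[of _ l]) (simp add: sum_negf)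
  qed
  then obtain l where "\<forall>v\<in>T. 0 \<le> l v" "\<forall>a<k. (\<Sum>v\<in>T. l v * y v a) = 0" "(\<Sum>v\<in>T. l v * y v k) \<noteq> 0"
    by blast
  moreover from this(3) have "\<exists>v\<in>T. l v \<noteq> 0" by (metis (mono_tags, lifting) mult_zero_left sum.neutral)
  ultimately show "hits_subspace y k T" unfolding hits_subspace_def by blast
qed

text \<open>The conditions \<open>t w \<le> s\<close> for \<open>w\<close> in \<open>S\<close> and \<open>s \<le> t w\<close> for the others cut out an interval of
  values \<open>s\<close>, and its end points are counted. A half-line has one, whereas a bounded interval has two or,
  if it is empty, none; a single point does not occur since \<open>t\<close> is injective.\<close>

lemma odd_attained_ends:
  fixes t :: "'a \<Rightarrow> real"
  assumes "finite T" "T \<noteq> {}" "inj_on t T" "S \<subseteq> T"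
  shows "odd (card {v\<in>T. (\<forall>w\<in>S. t w \<le> t v) \<and> (\<forall>w\<in>T - S. t v \<le> t w)}) \<longleftrightarrow> S = {} \<or> S = T"
    (is "odd (card ?V) \<longleftrightarrow> _")
proof -
  have eqI: "v = w" if "v \<in> T" "w \<in> T" "t v = t w" for v w
    using assms(3) that by (auto dest: inj_onD)
  have max: "\<exists>u\<in>U. \<forall>w\<in>U. t w \<le> t u" if U: "finite U" "U \<noteq> {}" for U
  proof -
    have "Max (t ` U) \<in> t ` U" using U by (intro Max_in) auto
    then obtain u where "u \<in> U" "t u = Max (t ` U)" by auto
    then show ?thesis using U by (intro bexI[of _ u]) auto
  qed
  have min: "\<exists>u\<in>U. \<forall>w\<in>U. t u \<le> t w" if U: "finite U" "U \<noteq> {}" for U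
  proof -
    have "Min (t ` U) \<in> t ` U" using U by (intro Min_in) auto
    then obtain u where "u \<in> U" "t u = Min (t ` U)" by auto
    then show ?thesis using U by (intro bexI[of _ u]) auto
  qed
  consider "S = {}" | "S = T" | "S \<noteq> {}" "S \<noteq> T" by blast
  then show ?thesis
  proof cases
    case 1
    obtain u where u: "u \<in> T" "\<forall>w\<in>T. t u \<le> t w" using min[of T] assms by blast
    then have "?V = {u}" using 1 by (auto intro!: eqI antisym)
    then show ?thesis using 1 by simp
  next
    case 2
    obtain u where u: "u \<in> T" "\<forall>w\<in>T. t w \<le> t u" using max[of T] assms by blast
    then have "?V = {u}" using 2 by (auto intro!: eqI antisym)
    then show ?thesis using 2 by simp
  next
    case 3
    have "finite S" "finite (T - S)" "T - S \<noteq> {}"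
      using 3 assms finite_subset by auto
    then obtain a b where a: "a \<in> S" "\<forall>w\<in>S. t w \<le> t a" and b: "b \<in> T - S" "\<forall>w\<in>T - S. t b \<le> t w"
      using max[of S] min[of "T - S"] 3 by blast
    have ab: "a \<noteq> b" using a b by blast
    have aT: "a \<in> T" "b \<in> T" using a(1) b(1) assms(4) by auto
    have "v = a \<or> v = b" if "v \<in> ?V" for v
    proof (cases "v \<in> S")
      case True
      then have "t v = t a" using that a by (intro antisym) auto
      then show ?thesis using eqI[of v a] that aT by simp
    next
      case False
      then have "t v = t b" using that b by (intro antisym) auto
      then show ?thesis using eqI[of v b] that aT by simp
    qed
    moreover have "a \<in> ?V \<longleftrightarrow> t a \<le> t b"
      using a b aT by (auto intro: order_trans)
    moreover have "b \<in> ?V \<longleftrightarrow> t a \<le> t b"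
      using a b aT by (auto intro: order_trans)
    ultimately have "?V = (if t a \<le> t b then {a, b} else {})" 
      using aT by (auto split: if_splits)
    then have "even (card ?V)" using ab by (simp split: if_splits)
    then show ?thesis using 3 by simp
  qed
qed

text \<open>The step in the parity count. The solutions that vanish in the first \<open>k\<close> coordinates and are 1
  in coordinate \<open>k\<close> form a line, and its nonnegative part is an interval whose end points lie on the
  facets of \<open>T\<close>. The number of end points is odd exactly when the line has a nonnegative direction, and a
  nonnegative direction is a nonnegative solution that vanishes in coordinate \<open>k\<close> as well.\<close>

lemma hits_halfspace_facets:
  assumes gp: "general_position y T" and card: "card T = Suc (Suc k)"
  shows "odd (card {v\<in>T. hits_halfspace y k (T - {v})}) \<longleftrightarrow> hits_subspace y (Suc k) T"
proof -
  have fin: "finite T" using card card.infinite by fastforce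
  have val: "(\<Sum>v\<in>T. l v * y v a) = (\<Sum>v\<in>T - {u}. l v * y v a)" if "u \<in> T" "l u = 0" for l u a
    using that fin by (simp add: sum.remove)
  \<comment> \<open>on a facet \<open>T - {u}\<close> the first \<open>k + 1\<close> coordinates are independent\<close>
  have facet_indep: "l v = 0" if "u \<in> T" "l u = 0" "\<And>a. a < Suc k \<Longrightarrow> (\<Sum>v\<in>T. l v * y v a) = 0" "v \<in> T"
    for l :: "'a \<Rightarrow> real" and u v
  proof (cases "v = u")
    case False
    have "card (T - {u}) = Suc k" using that(1) card fin by simp
    then show ?thesis
      using general_positionD[OF gp, of "T - {u}" "Suc k" l v] that False val[of u l] by auto
  qed (use that in simp)
  obtain m where m0: "\<exists>v\<in>T. m v \<noteq> 0" and m: "\<And>a. a < Suc k \<Longrightarrow> (\<Sum>v\<in>T. m v * y v a) = 0"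
    using nontrivial_solution[of "{..<Suc k}" T y] fin card by auto
  have m_nz: "m v \<noteq> 0" if "v \<in> T" for v
    using facet_indep[of v m] m m0 that by blast
  have "T \<noteq> {}" using card by auto
  then obtain u where u: "u \<in> T" by blast
  have "\<exists>q. (\<forall>a<k. (\<Sum>v\<in>T. q v * y v a) = 0) \<and> (\<Sum>v\<in>T. q v * y v k) = 1"
  proof -
    have "card {..<k} < card (T - {u})" using card u fin by simp
    then obtain q where q0: "\<exists>v\<in>T - {u}. q v \<noteq> 0" and q: "\<forall>a\<in>{..<k}. (\<Sum>v\<in>T - {u}. q v * y v a) = 0"
      using nontrivial_solution[of "{..<k}" "T - {u}" y] fin by auto
    define q' where "q' = q(u := 0)"
    have q': "(\<Sum>v\<in>T. q' v * y v a) = (\<Sum>v\<in>T - {u}. q v * y v a)" for a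
    proof -
      have "(\<Sum>v\<in>T. q' v * y v a) = (\<Sum>v\<in>T - {u}. q' v * y v a)"
        by (rule val) (use u in \<open>auto simp: q'_def\<close>)
      then show ?thesis by (simp add: q'_def)
    qed
    define r where "r = (\<Sum>v\<in>T. q' v * y v k)"
    have "r \<noteq> 0"
    proof
      assume "r = 0"
      then have "(\<Sum>v\<in>T. q' v * y v a) = 0" if "a < Suc k" for a
        using that q q' unfolding r_def by (auto simp: less_Suc_eq)
      then have "\<forall>v\<in>T. q' v = 0" using facet_indep[of u q'] u by (auto simp: q'_def)
      moreover obtain w where "w \<in> T" "w \<noteq> u" "q w \<noteq> 0" using q0 by blast
      ultimately show False by (metis fun_upd_other q'_def)
    qed
    moreover have "(\<Sum>v\<in>T. q' v / r * y v a) = (\<Sum>v\<in>T. q' v * y v a) / r" for a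
      by (simp add: sum_divide_distrib)
    ultimately show ?thesis
      using q q' by (intro exI[of _ "\<lambda>v. q' v / r"]) (auto simp: r_def)
  qed
  then obtain q where q: "\<And>a. a < k \<Longrightarrow> (\<Sum>v\<in>T. q v * y v a) = 0" and qk: "(\<Sum>v\<in>T. q v * y v k) = 1"
    by blast
  \<comment> \<open>the solutions with coordinate \<open>k\<close> equal to one form the line \<open>q + s m\<close>; it crosses the
    hyperplane \<open>l w = 0\<close> at the parameter \<open>t w\<close>\<close>
  define t where "t w = - q w / m w" for w
  define pt where "pt s v = q v + s * m v" for s v
  have pt_sum: "(\<Sum>v\<in>T. pt s v * y v a) = (\<Sum>v\<in>T. q v * y v a) + s * (\<Sum>v\<in>T. m v * y v a)" for s a
    by (simp add: pt_def distrib_right sum.distrib sum_distrib_left mult.assoc)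
  have pt: "(\<Sum>v\<in>T. pt s v * y v a) = (if a < k then 0 else 1)" if "a < Suc k" for s a
    unfolding pt_sum using that m q qk by (auto simp: less_Suc_eq)
  have pt_eq: "pt s v = (s - t v) * m v" if "v \<in> T" for s v
    using m_nz[OF that] by (simp add: pt_def t_def field_simps)
  have inj: "inj_on t T"
  proof (rule inj_onI, rule ccontr)
    fix v w assume vw: "v \<in> T" "w \<in> T" "t v = t w" "v \<noteq> w"
    have z: "pt (t v) v = 0" "pt (t v) w = 0" using vw pt_eq by auto
    have "card (T - {v, w}) = k" using vw card fin by (simp add: card_Diff_subset)
    moreover have s: "(\<Sum>x\<in>T. pt (t v) x * y x a) = (\<Sum>x\<in>T - {v, w}. pt (t v) x * y x a)" for a
      using vw z fin by (intro sum.mono_neutral_right) auto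
    ultimately have "pt (t v) x = 0" if "x \<in> T - {v, w}" for x
      using general_positionD[OF gp, of "T - {v, w}" k "pt (t v)" x] that pt[of _ "t v"] by auto
    then have "(\<Sum>x\<in>T. pt (t v) x * y x k) = 0" unfolding s by simp
    then show False using pt[of k "t v"] by simp
  qed
  define S where "S = {v\<in>T. 0 < m v}"
  have nonneg: "(\<forall>w\<in>T. 0 \<le> pt s w) \<longleftrightarrow> (\<forall>w\<in>S. t w \<le> s) \<and> (\<forall>w\<in>T - S. s \<le> t w)" for s
  proof -
    have "0 \<le> pt s w \<longleftrightarrow> (if w \<in> S then t w \<le> s else s \<le> t w)" if "w \<in> T" for w
      using m_nz[OF that] that by (auto simp: pt_eq S_def zero_le_mult_iff)
    then show ?thesis by (auto simp: S_def)
  qed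
  have hits: "hits_halfspace y k (T - {v}) \<longleftrightarrow> (\<forall>w\<in>T. 0 \<le> pt (t v) w)" if v: "v \<in> T" for v
  proof
    assume "hits_halfspace y k (T - {v})"
    then obtain l where l: "\<forall>w\<in>T - {v}. 0 \<le> l w" "\<forall>a<k. (\<Sum>w\<in>T - {v}. l w * y w a) = 0"
      "0 < (\<Sum>w\<in>T - {v}. l w * y w k)" unfolding hits_halfspace_def by blast
    define r where "r = (\<Sum>w\<in>T - {v}. l w * y w k)"
    define l' where "l' w = (if w = v then 0 else l w / r)" for w
    have l': "(\<Sum>w\<in>T. l' w * y w a) = (\<Sum>w\<in>T - {v}. l w * y w a) / r" for a
    proof -
      have "(\<Sum>w\<in>T. l' w * y w a) = (\<Sum>w\<in>T - {v}. l' w * y w a)"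
        by (rule val) (use v in \<open>auto simp: l'_def\<close>)
      then show ?thesis by (simp add: l'_def sum_divide_distrib)
    qed
    have "(\<Sum>w\<in>T. (l' w - pt (t v) w) * y w a) = 0" if "a < Suc k" for a
      using that l(2,3) pt[OF that, of "t v"] l'[of a]
      by (auto simp: left_diff_distrib sum_subtractf less_Suc_eq r_def)
    then have "l' w - pt (t v) w = 0" if "w \<in> T" for w
      using facet_indep[of v "\<lambda>w. l' w - pt (t v) w" w] v that pt_eq[OF v, of "t v"]
      by (auto simp: l'_def)
    moreover have "0 \<le> l' w" if "w \<in> T" for w
      using that l(1,3) by (simp add: l'_def r_def)
    ultimately show "\<forall>w\<in>T. 0 \<le> pt (t v) w" by fastforce
  next
    assume "\<forall>w\<in>T. 0 \<le> pt (t v) w"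
    moreover have "(\<Sum>w\<in>T - {v}. pt (t v) w * y w a) = (\<Sum>w\<in>T. pt (t v) w * y w a)" for a
      using val[OF v, of "pt (t v)" a] pt_eq[OF v, of "t v"] by simp
    ultimately show "hits_halfspace y k (T - {v})"
      unfolding hits_halfspace_def using pt[of _ "t v"] by (intro exI[of _ "pt (t v)"]) auto
  qed
  have "{v\<in>T. hits_halfspace y k (T - {v})} = {v\<in>T. (\<forall>w\<in>S. t w \<le> t v) \<and> (\<forall>w\<in>T - S. t v \<le> t w)}"
    using hits nonneg by auto
  then have "odd (card {v\<in>T. hits_halfspace y k (T - {v})}) \<longleftrightarrow> S = {} \<or> S = T"
    using odd_attained_ends[OF fin \<open>T \<noteq> {}\<close> inj, of S] by (simp add: S_def)
  also have "\<dots> \<longleftrightarrow> hits_subspace y (Suc k) T"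
  proof
    assume "S = {} \<or> S = T"
    then show "hits_subspace y (Suc k) T"
    proof
      assume "S = {}"
      then have "\<forall>v\<in>T. 0 \<le> - m v" by (auto simp: S_def not_less)
      then show ?thesis unfolding hits_subspace_def
        using m m0 by (intro exI[of _ "\<lambda>v. - m v"]) (auto simp: sum_negf)
    next
      assume "S = T"
      then have "\<forall>v\<in>T. 0 < m v" unfolding S_def by blast
      then have "\<forall>v\<in>T. 0 \<le> m v" by (simp add: less_imp_le)
      then show ?thesis unfolding hits_subspace_def
        using m m0 by (intro exI[of _ m]) auto
    qed
  next
    assume "hits_subspace y (Suc k) T"
    then obtain l where l: "\<forall>v\<in>T. 0 \<le> l v" "\<exists>v\<in>T. l v \<noteq> 0"
      "\<forall>a<Suc k. (\<Sum>v\<in>T. l v * y v a) = 0" unfolding hits_subspace_def by blast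
    \<comment> \<open>\<open>l\<close> is a multiple of \<open>m\<close>\<close>
    define s where "s = l u / m u"
    have "l v - s * m v = 0" if "v \<in> T" for v
    proof (rule facet_indep[of u "\<lambda>v. l v - s * m v" v])
      show "l u - s * m u = 0" using m_nz[OF u] by (simp add: s_def)
      fix a assume "a < Suc k"
      then have "(\<Sum>v\<in>T. l v * y v a) - s * (\<Sum>v\<in>T. m v * y v a) = 0" using l(3) m by simp
      then show "(\<Sum>v\<in>T. (l v - s * m v) * y v a) = 0"
        by (simp add: left_diff_distrib sum_subtractf sum_distrib_left mult.assoc)
    qed (use u that in auto)
    then have lm: "l v = s * m v" if "v \<in> T" for v using that by force
    then have "s \<noteq> 0" using l(2) by auto
    have sm: "0 \<le> s * m v" if "v \<in> T" for v
      using l(1) lm[OF that] that by metis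
    from \<open>s \<noteq> 0\<close> consider "s > 0" | "s < 0" by linarith
    then show "S = {} \<or> S = T"
    proof cases
      case 1
      then have "0 < m v" if "v \<in> T" for v
        using sm[OF that] m_nz[OF that] by (auto simp: zero_le_mult_iff)
      then have "S = T" unfolding S_def by blast
      then show ?thesis ..
    next
      case 2
      then have "m v < 0" if "v \<in> T" for v
        using sm[OF that] m_nz[OF that] by (auto simp: zero_le_mult_iff)
      then have "S = {}" unfolding S_def by (auto dest: less_asym)
      then show ?thesis ..
    qed
  qed
  finally show ?thesis .
qed

section \<open>A Borsuk-Ulam theorem for matroid-valued carriers\<close>

text \<open>An equivariant carrier \<open>B\<close> from the cells of the sphere to sets of vertices, whose values have rank
  above \<open>d\<close> and so carry no homology below dimension \<open>d\<close>.\<close>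

locale antipodal_carrier =
  fixes E :: "'a set" and M :: "'a set set" and \<nu> :: "'a \<Rightarrow> 'a"
    and B :: "(nat \<Rightarrow> int) \<Rightarrow> 'a set" and d :: nat and N :: int
  assumes matroid: "matroid E M"
    and even_N: "even N" and N_pos: "0 < N"
    and \<nu>_in: "v \<in> E \<Longrightarrow> \<nu> v \<in> E" and \<nu>_\<nu>: "v \<in> E \<Longrightarrow> \<nu> (\<nu> v) = v"
    and \<nu>_M: "J \<in> M \<Longrightarrow> \<nu> ` J \<in> M"
    and B_subset: "c \<in> sphere_cells d N \<Longrightarrow> B c \<subseteq> E"
    and B_face: "c \<in> sphere_cells d N \<Longrightarrow> p \<in> flags c \<Longrightarrow> B (face c p) \<subseteq> B c"
    and B_uminus: "c \<in> sphere_cells d N \<Longrightarrow> B (- c) = \<nu> ` B c"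
    and B_rank: "c \<in> sphere_cells d N \<Longrightarrow> \<exists>I\<in>M. I \<subseteq> B c \<and> d < card I"
begin

lemma finite_E: "finite E"
  using matroid by (simp add: matroid_def)

lemma M_subset: "J \<in> M \<Longrightarrow> J \<subseteq> E"
  using matroid by (auto simp: matroid_def)

lemma \<nu>_image_subset: "J \<subseteq> E \<Longrightarrow> \<nu> ` J \<subseteq> E"
  using \<nu>_in by blast

lemma \<nu>_\<nu>_image: "J \<subseteq> E \<Longrightarrow> \<nu> ` \<nu> ` J = J"
  using \<nu>_\<nu> by (force simp: image_image)

lemma inj_on_\<nu>: "J \<subseteq> E \<Longrightarrow> inj_on \<nu> J"
  using \<nu>_\<nu> by (metis inj_onI subsetD)

lemma card_\<nu>_image: "J \<subseteq> E \<Longrightarrow> card (\<nu> ` J) = card J"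
  using inj_on_\<nu> card_image by blast

text \<open>The pullback of a chain along the involution. The value 0 outside of the ground set is needed
  because nothing is known of \<open>\<nu>\<close> there.\<close>

definition twist :: "('a set \<Rightarrow> bit) \<Rightarrow> 'a set \<Rightarrow> bit"
  where "twist z J = (if J \<subseteq> E then z (\<nu> ` J) else 0)"

lemma bdry_twist: "bdry E (twist z) J = twist (bdry E z) J"
proof (cases "J \<subseteq> E")
  case True
  have "bdry E (twist z) J = (\<Sum>v\<in>E - J. z (insert (\<nu> v) (\<nu> ` J)))"
    unfolding bdry_def twist_def using True by (intro sum.cong) auto
  also have "\<dots> = (\<Sum>v\<in>E - \<nu> ` J. z (insert v (\<nu> ` J)))"
  proof (rule sum.reindex_bij_witness[of _ \<nu> \<nu>])
    fix v assume "v \<in> E - J"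
    then show "\<nu> (\<nu> v) = v" "\<nu> v \<in> E - \<nu> ` J"
      using \<nu>_\<nu> \<nu>_in True by (auto, metis subsetD)
  next
    fix v assume "v \<in> E - \<nu> ` J"
    then show "\<nu> (\<nu> v) = v" "\<nu> v \<in> E - J"
      using \<nu>_\<nu> \<nu>_in by (auto, metis image_eqI)
  qed auto
  finally show ?thesis using True by (simp add: bdry_def twist_def)
next
  case False
  then show ?thesis by (auto simp: bdry_def twist_def)
qed

text \<open>What an equivariant chain map has to satisfy on the cell \<open>c\<close>. The boundary of a vertex is the empty
  simplex, so a vertex goes to a 0-chain with an odd number of points.\<close>

definition chain_map_at :: "((nat \<Rightarrow> int) \<Rightarrow> 'a set \<Rightarrow> bit) \<Rightarrow> (nat \<Rightarrow> int) \<Rightarrow> bool"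
  where "chain_map_at \<phi> c \<longleftrightarrow>
    (\<forall>J. \<phi> c J \<noteq> 0 \<longrightarrow> J \<in> M \<and> J \<subseteq> B c \<and> card J = Suc (card (odds c))) \<and>
    (\<forall>J. bdry E (\<phi> c) J = (\<Sum>p\<in>flags c. \<phi> (face c p) J) + of_bool (odds c = {} \<and> J = {})) \<and>
    (\<forall>J\<subseteq>E. \<phi> (- c) J = \<phi> c (\<nu> ` J))"

text \<open>The image of the boundary of a cell is a cycle carried by \<open>B c\<close> and of dimension below \<open>d\<close>, so it
  bounds there.\<close>

lemma boundary_chain_bounds:
  assumes c: "c \<in> sphere_cells d N" and dim: "card (odds c) \<le> d"
    and \<phi>: "\<And>p. p \<in> flags c \<Longrightarrow> chain_map_at \<phi> (face c p)"
  shows "\<exists>z. (\<forall>J. z J \<noteq> 0 \<longrightarrow> J \<in> M \<and> J \<subseteq> B c \<and> card J = Suc (card (odds c))) \<and>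
    (\<forall>J. bdry E z J = (\<Sum>p\<in>flags c. \<phi> (face c p) J) + of_bool (odds c = {} \<and> J = {}))"
proof -
  define w where "w J = (\<Sum>p\<in>flags c. \<phi> (face c p) J) + of_bool (odds c = {} \<and> J = {})" for J
  have fin: "finite (odds c)" using c by (rule finite_odds_sphere_cells)
  have "\<exists>z. (\<forall>J. z J \<noteq> 0 \<longrightarrow> J \<in> {I\<in>M. I \<subseteq> B c} \<and> card J = Suc (card (odds c))) \<and>
    (\<forall>J. bdry E z J = w J)"
  proof -
    obtain I where I: "I \<in> M" "I \<subseteq> B c" "d < card I" using B_rank[OF c] by blast
    show ?thesis
    proof (rule matroid_cycle_bounds[OF finite_E B_subset[OF c]])
      show "matroid (B c) {I\<in>M. I \<subseteq> B c}"
        by (rule matroid_restrict[OF matroid B_subset[OF c]])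
      show "I \<in> {I\<in>M. I \<subseteq> B c}" "card (odds c) < card I" using I dim by auto
    next
      fix J assume "w J \<noteq> 0"
      then consider p where "p \<in> flags c" "\<phi> (face c p) J \<noteq> 0" | "odds c = {}" "J = {}"
      proof (cases "odds c = {} \<and> J = {}")
        case False
        then have "of_bool (odds c = {} \<and> J = {}) = (0 :: bit)" by (subst of_bool_eq_0_iff)
        then have "(\<Sum>p\<in>flags c. \<phi> (face c p) J) \<noteq> 0"
          using \<open>w J \<noteq> 0\<close> unfolding w_def by (metis add_0_right)
        then obtain p where "p \<in> flags c" "\<phi> (face c p) J \<noteq> 0"
          by (rule sum.not_neutral_contains_not_neutral)
        then show ?thesis by (rule that(1))
      qed (use that in blast)
      then show "J \<in> {I\<in>M. I \<subseteq> B c} \<and> card J = card (odds c)"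
      proof cases
        case 1
        then have J: "J \<in> M" "J \<subseteq> B (face c p)" "card J = Suc (card (odds (face c p)))"
          using conjunct1[OF \<phi>[OF 1(1), unfolded chain_map_at_def], rule_format, OF 1(2)] by auto
        have p: "fst p \<in> odds c" using 1(1) by (auto simp: flags_def)
        have "card J = card (odds c)"
          by (simp only: J(3) odds_face[OF 1(1)] card.remove[OF fin p])
        then show ?thesis using J B_face[OF c 1(1)] by auto
      next
        case 2
        then show ?thesis using matroid by (auto simp: matroid_def)
      qed
    next
      fix J
      have "bdry E w J = (\<Sum>p\<in>flags c. bdry E (\<phi> (face c p)) J)"
        unfolding w_def by (subst bdry_add, subst bdry_sum) (simp add: bdry_def)
      also have "\<dots> = (\<Sum>p\<in>flags c. \<Sum>q\<in>flags (face c p). \<phi> (face (face c p) q) J) +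
          (\<Sum>p\<in>flags c. of_bool (odds (face c p) = {} \<and> J = {}))"
        using \<phi> by (simp add: chain_map_at_def flip: sum.distrib)
      also have "(\<Sum>p\<in>flags c. \<Sum>q\<in>flags (face c p). \<phi> (face (face c p) q) J) = 0"
        using fin by (rule faces_of_faces_cancel)
      also have "(\<Sum>p\<in>flags c. of_bool (odds (face c p) = {} \<and> J = {})) = (0 :: bit)"
      proof (rule bit_sum_involution[where \<tau> = "\<lambda>p. (fst p, - snd p)"])
        fix p assume p: "p \<in> flags c"
        then show \<tau>p: "(fst p, - snd p) \<in> flags c" by (auto simp: flags_def)
        show "of_bool (odds (face c (fst p, - snd p)) = {} \<and> J = {}) =
            (of_bool (odds (face c p) = {} \<and> J = {}) :: bit)"
          using odds_face[OF p] odds_face[OF \<tau>p] by simp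
      qed (use finite_flags[OF fin] in \<open>auto simp: flags_def\<close>)
      finally show "bdry E w J = 0" by simp
    qed
  qed
  then show ?thesis unfolding w_def by auto
qed

text \<open>Any choice of one cell from each antipodal pair would do; this one uses the sign of the first
  nonzero coordinate.\<close>

definition positive_cell :: "(nat \<Rightarrow> int) \<Rightarrow> bool"
  where "positive_cell c \<longleftrightarrow> 0 < c (LEAST i. c i \<noteq> 0)"

lemma positive_cell_uminus:
  assumes "c \<in> sphere_cells d N"
  shows "positive_cell (- c) \<longleftrightarrow> \<not> positive_cell c"
proof -
  have "\<exists>i. c i \<noteq> 0" using assms N_pos by (auto simp: sphere_cells_def)
  then have "c (LEAST i. c i \<noteq> 0) \<noteq> 0" by (rule LeastI_ex)
  then show ?thesis by (auto simp: positive_cell_def)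
qed

text \<open>Cell by cell, in order of dimension: choose a filling on one cell of each antipodal pair and
  transport it to the other by the involution.\<close>

lemma equivariant_chain_map_below:
  assumes "k \<le> Suc d"
  shows "\<exists>\<phi>. \<forall>c\<in>sphere_cells d N. card (odds c) < k \<longrightarrow> chain_map_at \<phi> c"
  using assms
proof (induction k)
  case (Suc k)
  then obtain \<phi> where \<phi>: "\<And>c. c \<in> sphere_cells d N \<Longrightarrow> card (odds c) < k \<Longrightarrow> chain_map_at \<phi> c"
    by auto
  have face_dim: "card (odds (face c p)) < card (odds c)" if "c \<in> sphere_cells d N" "p \<in> flags c" for c p
    unfolding odds_face[OF that(2)]
    using finite_odds_sphere_cells[OF that(1)] that(2) by (intro card_Diff1_less) (auto simp: flags_def)
  have "\<forall>c\<in>{c\<in>sphere_cells d N. card (odds c) = k}. \<exists>z.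
    (\<forall>J. z J \<noteq> 0 \<longrightarrow> J \<in> M \<and> J \<subseteq> B c \<and> card J = Suc (card (odds c))) \<and>
    (\<forall>J. bdry E z J = (\<Sum>p\<in>flags c. \<phi> (face c p) J) + of_bool (odds c = {} \<and> J = {}))"
  proof
    fix c assume c: "c \<in> {c\<in>sphere_cells d N. card (odds c) = k}"
    have "chain_map_at \<phi> (face c p)" if "p \<in> flags c" for p
      using c that \<phi> face_dim face_in_sphere_cells[OF even_N] by auto
    then show "\<exists>z. (\<forall>J. z J \<noteq> 0 \<longrightarrow> J \<in> M \<and> J \<subseteq> B c \<and> card J = Suc (card (odds c))) \<and>
      (\<forall>J. bdry E z J = (\<Sum>p\<in>flags c. \<phi> (face c p) J) + of_bool (odds c = {} \<and> J = {}))"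
      using c Suc.prems by (intro boundary_chain_bounds) auto
  qed
  from bchoice[OF this] obtain F where F: "\<forall>c\<in>{c\<in>sphere_cells d N. card (odds c) = k}.
    (\<forall>J. F c J \<noteq> 0 \<longrightarrow> J \<in> M \<and> J \<subseteq> B c \<and> card J = Suc (card (odds c))) \<and>
    (\<forall>J. bdry E (F c) J = (\<Sum>p\<in>flags c. \<phi> (face c p) J) + of_bool (odds c = {} \<and> J = {}))"
    by (elim exE)
  have F_supp: "J \<in> M \<and> J \<subseteq> B c \<and> card J = Suc k"
    if "c \<in> sphere_cells d N" "card (odds c) = k" "F c J \<noteq> 0" for c J
    using F that by simp
  have F_bdry: "bdry E (F c) J = (\<Sum>p\<in>flags c. \<phi> (face c p) J) + of_bool (odds c = {} \<and> J = {})"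
    if "c \<in> sphere_cells d N" "card (odds c) = k" for c J
    using F that by simp
  define \<psi> where "\<psi> c = (if card (odds c) = k
    then if positive_cell c then F c else twist (F (- c)) else \<phi> c)" for c
  have \<psi>_face: "\<psi> (face c p) = \<phi> (face c p)"
    if "c \<in> sphere_cells d N" "card (odds c) \<le> k" "p \<in> flags c" for c p
    using face_dim[OF that(1,3)] that(2) by (simp add: \<psi>_def)
  have "chain_map_at \<psi> c" if c: "c \<in> sphere_cells d N" and dim: "card (odds c) < Suc k" for c
  proof (cases "card (odds c) = k")
    case False
    then have "chain_map_at \<phi> c" using \<phi>[OF c] dim by simp
    moreover have "\<psi> c = \<phi> c" "\<psi> (- c) = \<phi> (- c)" using False by (simp_all add: \<psi>_def)
    ultimately show ?thesis
      using \<psi>_face[OF c] dim unfolding chain_map_at_def by simp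
  next
    case k: True
    have nc: "- c \<in> sphere_cells d N" using c uminus_in_sphere_cells by blast
    show ?thesis
    proof (cases "positive_cell c")
      case True
      have "\<psi> c = F c" "\<psi> (- c) = twist (F c)"
        using True k positive_cell_uminus[OF c] by (simp_all add: \<psi>_def)
      then show ?thesis
        using F_supp[OF c k] F_bdry[OF c k] \<psi>_face[OF c] dim k
        unfolding chain_map_at_def by (simp add: twist_def)
    next
      case False
      have \<psi>: "\<psi> c = twist (F (- c))" "\<psi> (- c) = F (- c)"
        using False k positive_cell_uminus[OF c] by (simp_all add: \<psi>_def)
      show ?thesis
        unfolding chain_map_at_def
      proof (intro conjI allI impI)
        fix J assume "\<psi> c J \<noteq> 0"
        then have JE: "J \<subseteq> E" and nz: "F (- c) (\<nu> ` J) \<noteq> 0"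
          unfolding \<psi> twist_def by (auto split: if_splits)
        then have J: "\<nu> ` J \<in> M" "\<nu> ` J \<subseteq> B (- c)" "card (\<nu> ` J) = Suc k"
          using F_supp[OF nc _ nz] k by auto
        show "J \<in> M" using \<nu>_M[OF J(1)] \<nu>_\<nu>_image[OF JE] by simp
        show "card J = Suc (card (odds c))" using J(3) card_\<nu>_image[OF JE] k by simp
        have "\<nu> ` \<nu> ` J \<subseteq> \<nu> ` \<nu> ` B c" using J(2) B_uminus[OF c] by blast
        then show "J \<subseteq> B c" using \<nu>_\<nu>_image JE B_subset[OF c] by simp
      next
        fix J
        show "bdry E (\<psi> c) J = (\<Sum>p\<in>flags c. \<psi> (face c p) J) + of_bool (odds c = {} \<and> J = {})"
        proof (cases "J \<subseteq> E")
          case JE: True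
          have "bdry E (\<psi> c) J = (\<Sum>p\<in>flags (- c). \<phi> (face (- c) p) (\<nu> ` J)) + of_bool (odds c = {} \<and> J = {})"
            unfolding \<psi> bdry_twist using JE F_bdry[OF nc] k by (simp add: twist_def)
          also have "(\<Sum>p\<in>flags (- c). \<phi> (face (- c) p) (\<nu> ` J)) = (\<Sum>p\<in>flags c. \<phi> (- face c p) (\<nu> ` J))"
            by (rule sum_flags_uminus)
          also have "\<dots> = (\<Sum>p\<in>flags c. \<psi> (face c p) J)"
          proof (rule sum.cong[OF refl])
            fix p assume p: "p \<in> flags c"
            have "chain_map_at \<phi> (face c p)"
              using \<phi> face_in_sphere_cells[OF even_N c p] face_dim[OF c p] k by simp
            then have "\<phi> (- face c p) (\<nu> ` J) = \<phi> (face c p) (\<nu> ` \<nu> ` J)"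
              using \<nu>_image_subset[OF JE] unfolding chain_map_at_def by blast
            then show "\<phi> (- face c p) (\<nu> ` J) = \<psi> (face c p) J"
              using \<nu>_\<nu>_image[OF JE] \<psi>_face[OF c _ p] k by simp
          qed
          finally show ?thesis .
        next
          case JE: False
          have "\<psi> (face c p) J = 0" if p: "p \<in> flags c" for p
          proof -
            have "chain_map_at \<phi> (face c p)"
              using \<phi> face_in_sphere_cells[OF even_N c p] face_dim[OF c p] k by simp
            then have "\<phi> (face c p) J = 0"
              using M_subset JE unfolding chain_map_at_def by blast
            then show ?thesis using \<psi>_face[OF c _ p] k by simp
          qed
          moreover have "J \<noteq> {}" using JE by auto
          ultimately show ?thesis using JE unfolding \<psi> bdry_twist by (simp add: twist_def)
        qed
      next
        fix J assume JE: "J \<subseteq> E"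
        show "\<psi> (- c) J = \<psi> c (\<nu> ` J)"
          unfolding \<psi> using \<nu>_image_subset[OF JE] \<nu>_\<nu>_image[OF JE] by (simp add: twist_def)
      qed
    qed
  qed
  then show ?case by blast
qed simp

lemma hits_halfspace_\<nu>:
  assumes odd: "\<And>v a. v \<in> E \<Longrightarrow> y (\<nu> v) a = - y v a" and T: "T \<subseteq> E"
  shows "hits_halfspace y k (\<nu> ` T) \<longleftrightarrow> hits_halfspace (\<lambda>v a. - y v a) k T"
proof -
  have eq: "(\<Sum>v\<in>\<nu> ` T. l v * y v a) = (\<Sum>v\<in>T. l (\<nu> v) * - y v a)" for l a
  proof -
    have "(\<Sum>v\<in>\<nu> ` T. l v * y v a) = (\<Sum>v\<in>T. l (\<nu> v) * y (\<nu> v) a)"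
      by (simp add: sum.reindex[OF inj_on_\<nu>[OF T]])
    also have "\<dots> = (\<Sum>v\<in>T. l (\<nu> v) * - y v a)"
      using odd[OF subsetD[OF T]] by (intro sum.cong refl) simp
    finally show ?thesis .
  qed
  show ?thesis
  proof
    assume "hits_halfspace y k (\<nu> ` T)"
    then obtain l where "\<forall>v\<in>\<nu> ` T. 0 \<le> l v" "\<forall>a<k. (\<Sum>v\<in>\<nu> ` T. l v * y v a) = 0"
      "0 < (\<Sum>v\<in>\<nu> ` T. l v * y v k)" unfolding hits_halfspace_def by blast
    then show "hits_halfspace (\<lambda>v a. - y v a) k T"
      unfolding hits_halfspace_def eq by (intro exI[of _ "\<lambda>v. l (\<nu> v)"]) auto
  next
    assume "hits_halfspace (\<lambda>v a. - y v a) k T"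
    then obtain l where l: "\<forall>v\<in>T. 0 \<le> l v" "\<forall>a<k. (\<Sum>v\<in>T. l v * - y v a) = 0"
      "0 < (\<Sum>v\<in>T. l v * - y v k)" unfolding hits_halfspace_def by blast
    have "(\<Sum>v\<in>\<nu> ` T. l (\<nu> v) * y v a) = (\<Sum>v\<in>T. l v * - y v a)" for a
      unfolding eq using \<nu>_\<nu>[OF subsetD[OF T]] by (intro sum.cong refl) simp
    then show "hits_halfspace y k (\<nu> ` T)"
      unfolding hits_halfspace_def using l T \<nu>_\<nu> by (intro exI[of _ "\<lambda>v. l (\<nu> v)"]) auto
  qed
qed

text \<open>Exchanging the sums over simplices and their facets reduces this to the pivoting count on a
  single simplex.\<close>

lemma sum_bdry_hits:
  assumes gp: "\<And>J. J \<in> M \<Longrightarrow> general_position y J"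
    and z: "\<And>J. z J \<noteq> 0 \<Longrightarrow> J \<in> M \<and> card J = Suc (Suc k)"
  shows "(\<Sum>J\<in>Pow E. bdry E z J * of_bool (hits_halfspace y k J)) =
    (\<Sum>T\<in>Pow E. z T * of_bool (hits_subspace y (Suc k) T))"
proof -
  let ?h = "\<lambda>J. of_bool (hits_halfspace y k J) :: bit"
  have "(\<Sum>J\<in>Pow E. bdry E z J * ?h J) =
      (\<Sum>(J, v)\<in>(SIGMA J:Pow E. E - J). z (insert v J) * ?h J)"
    unfolding bdry_def sum_distrib_right using finite_E by (subst sum.Sigma) auto
  also have "\<dots> = (\<Sum>(T, v)\<in>(SIGMA T:Pow E. T). z T * ?h (T - {v}))"
    by (rule sum.reindex_bij_witness[of _ "\<lambda>(T, v). (T - {v}, v)" "\<lambda>(J, v). (insert v J, v)"])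
       (auto simp: insert_absorb)
  also have "\<dots> = (\<Sum>T\<in>Pow E. z T * (\<Sum>v\<in>T. ?h (T - {v})))"
    unfolding sum_distrib_left using finite_E by (subst sum.Sigma) (auto intro: finite_subset)
  also have "\<dots> = (\<Sum>T\<in>Pow E. z T * of_bool (hits_subspace y (Suc k) T))"
  proof (rule sum.cong[OF refl])
    fix T assume T: "T \<in> Pow E"
    show "z T * (\<Sum>v\<in>T. ?h (T - {v})) = z T * of_bool (hits_subspace y (Suc k) T)"
    proof (cases "z T = 0")
      case False
      then have "T \<in> M" "card T = Suc (Suc k)" using z by blast+
      then have "odd (card {v\<in>T. hits_halfspace y k (T - {v})}) \<longleftrightarrow> hits_subspace y (Suc k) T"
        by (intro hits_halfspace_facets gp)
      moreover have "finite T" using T finite_E finite_subset by auto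
      ultimately show ?thesis by (simp only: bit_sum_of_bool)
    qed simp
  qed
  finally show ?thesis .
qed

lemma sum_hits_split:
  fixes z :: "'a set \<Rightarrow> bit"
  assumes odd: "\<And>v a. v \<in> E \<Longrightarrow> y (\<nu> v) a = - y v a"
    and gp: "\<And>J. J \<in> M \<Longrightarrow> general_position y J"
    and z: "\<And>J. z J \<noteq> 0 \<Longrightarrow> J \<in> M \<and> card J = Suc k"
  shows "(\<Sum>T\<in>Pow E. z T * of_bool (hits_subspace y k T)) =
    (\<Sum>T\<in>Pow E. (z T + z (\<nu> ` T)) * of_bool (hits_halfspace y k T))"
proof -
  have "(\<Sum>T\<in>Pow E. z T * of_bool (hits_subspace y k T)) =
      (\<Sum>T\<in>Pow E. z T * of_bool (hits_halfspace y k T) + z T * of_bool (hits_halfspace y k (\<nu> ` T)))"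
  proof (rule sum.cong[OF refl])
    fix T assume T: "T \<in> Pow E"
    show "z T * of_bool (hits_subspace y k T) =
      z T * of_bool (hits_halfspace y k T) + z T * of_bool (hits_halfspace y k (\<nu> ` T))"
    proof (cases "z T = 0")
      case False
      then have "hits_subspace y k T \<longleftrightarrow> hits_halfspace y k T \<noteq> hits_halfspace (\<lambda>v a. - y v a) k T"
        using z gp by (intro hits_subspace_split) auto
      also have "hits_halfspace (\<lambda>v a. - y v a) k T \<longleftrightarrow> hits_halfspace y k (\<nu> ` T)"
        using hits_halfspace_\<nu>[of y T k, OF odd] T by auto
      finally show ?thesis
        by (cases "hits_halfspace y k T"; cases "hits_halfspace y k (\<nu> ` T)") simp_all
    qed simp
  qed
  also have "\<dots> = (\<Sum>T\<in>Pow E. z T * of_bool (hits_halfspace y k T)) +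
      (\<Sum>T\<in>Pow E. z T * of_bool (hits_halfspace y k (\<nu> ` T)))"
    by (rule sum.distrib)
  also have "(\<Sum>T\<in>Pow E. z T * of_bool (hits_halfspace y k (\<nu> ` T))) =
      (\<Sum>T\<in>Pow E. z (\<nu> ` T) * of_bool (hits_halfspace y k T))"
    by (rule sum.reindex_bij_witness[of _ "image \<nu>" "image \<nu>"])
       (simp_all add: \<nu>_\<nu>_image \<nu>_image_subset)
  finally show ?thesis by (simp only: sum.distrib distrib_right)
qed

text \<open>The number of simplices in the image of \<open>hemisphere N k\<close> that hit the \<open>k\<close>-th coordinate subspace is
  odd for every \<open>k \<le> d\<close>, by induction on \<open>k\<close>. For \<open>k = 0\<close> it is the number of points in the image
  of a vertex. In the step, the count for \<open>k + 1\<close> is the number of facets that hit the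
  half-space, hence the number of simplices hitting the half-space in the image of
  \<open>hemisphere N k\<close> plus its antipode, which is the count for \<open>k\<close>.\<close>

theorem antipodal_zero:
  assumes odd: "\<And>v a. v \<in> E \<Longrightarrow> y (\<nu> v) a = - y v a"
    and gp: "\<And>J. J \<in> M \<Longrightarrow> general_position y J"
  shows "\<exists>c\<in>sphere_cells d N. \<exists>J\<in>M. J \<subseteq> B c \<and> card J = Suc d \<and> hits_subspace y d J"
proof -
  obtain \<phi> where \<phi>: "\<And>c. c \<in> sphere_cells d N \<Longrightarrow> card (odds c) \<le> d \<Longrightarrow> chain_map_at \<phi> c"
    using equivariant_chain_map_below[of "Suc d"] by (auto simp: less_Suc_eq_le)
  define \<Phi> where "\<Phi> k J = (\<Sum>c\<in>hemisphere N k. \<phi> c J)" for k J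
  have hemi: "c \<in> sphere_cells d N" "card (odds c) = k" "chain_map_at \<phi> c"
    if "c \<in> hemisphere N k" "k \<le> d" for c k
    using that hemisphere_subset[OF N_pos that(2)] odds_hemisphere[OF even_N that(1)] \<phi>[of c] by auto
  have supp: "J \<in> M \<and> card J = Suc k" if J: "\<Phi> k J \<noteq> 0" and k: "k \<le> d" for k J
  proof -
    obtain c where c: "c \<in> hemisphere N k" "\<phi> c J \<noteq> 0"
      using J unfolding \<Phi>_def by (rule sum.not_neutral_contains_not_neutral)
    then show ?thesis using hemi[OF c(1) k] unfolding chain_map_at_def by metis
  qed
  have bdry_\<Phi>: "bdry E (\<Phi> (Suc k)) J = \<Phi> k J + \<Phi> k (\<nu> ` J)" if "Suc k \<le> d" "J \<subseteq> E" for k J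
  proof -
    have "bdry E (\<Phi> (Suc k)) J = (\<Sum>c\<in>hemisphere N (Suc k). bdry E (\<phi> c) J)"
      unfolding \<Phi>_def by (rule bdry_sum)
    also have "\<dots> = (\<Sum>c\<in>hemisphere N (Suc k). \<Sum>p\<in>flags c. \<phi> (face c p) J)"
    proof (rule sum.cong[OF refl])
      fix c assume c: "c \<in> hemisphere N (Suc k)"
      have "odds c \<noteq> {}" using hemi(2)[OF c that(1)] by auto
      then show "bdry E (\<phi> c) J = (\<Sum>p\<in>flags c. \<phi> (face c p) J)"
        using hemi(3)[OF c that(1)] by (simp add: chain_map_at_def)
    qed
    also have "\<dots> = (\<Sum>c\<in>hemisphere N k. \<phi> c J + \<phi> (- c) J)"
      by (rule boundary_hemisphere[OF even_N N_pos])
    also have "\<dots> = (\<Sum>c\<in>hemisphere N k. \<phi> c J + \<phi> c (\<nu> ` J))"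
    proof (rule sum.cong[OF refl])
      fix c assume "c \<in> hemisphere N k"
      then have "chain_map_at \<phi> c" using hemi(3) that(1) by simp
      then show "\<phi> c J + \<phi> (- c) J = \<phi> c J + \<phi> c (\<nu> ` J)"
        using that(2) by (simp add: chain_map_at_def)
    qed
    finally show ?thesis by (simp add: \<Phi>_def sum.distrib)
  qed
  have one: "(\<Sum>T\<in>Pow E. \<Phi> k T * of_bool (hits_subspace y k T)) = 1" if "k \<le> d" for k
    using that
  proof (induction k)
    case 0
    define c0 :: "nat \<Rightarrow> int" where "c0 = (\<lambda>i. if i = 0 then N else 0)"
    have h0: "hemisphere N 0 = {c0}"
      using N_pos by (auto simp: hemisphere_def c0_def fun_eq_iff)
    \<comment> \<open>the hemisphere of dimension 0 is a single vertex, with image of odd augmentation\<close>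
    have c0: "chain_map_at \<phi> c0" "odds c0 = {}" "flags c0 = {}"
      using hemi(3)[of c0 0] even_N by (auto simp: h0 odds_def flags_def c0_def)
    have "(\<Sum>T\<in>Pow E. \<Phi> 0 T * of_bool (hits_subspace y 0 T)) =
        (\<Sum>T\<in>(\<lambda>v. {v}) ` E. \<Phi> 0 T * of_bool (hits_subspace y 0 T))"
    proof (rule sum.mono_neutral_right)
      show "\<forall>T\<in>Pow E - (\<lambda>v. {v}) ` E. \<Phi> 0 T * of_bool (hits_subspace y 0 T) = 0"
      proof
        fix T assume T: "T \<in> Pow E - (\<lambda>v. {v}) ` E"
        then have "card T \<noteq> Suc 0" by (auto simp: card_1_singleton_iff)
        then have "\<Phi> 0 T = 0" using supp[of 0 T, OF _ le0] by blast
        then show "\<Phi> 0 T * of_bool (hits_subspace y 0 T) = 0" by simp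
      qed
    qed (use finite_E in auto)
    also have "\<dots> = (\<Sum>v\<in>E. \<Phi> 0 {v} * of_bool (hits_subspace y 0 {v}))"
      by (subst sum.reindex) auto
    also have "\<dots> = (\<Sum>v\<in>E. \<phi> c0 {v})"
    proof (rule sum.cong[OF refl])
      fix v
      have "hits_subspace y 0 {v}"
        unfolding hits_subspace_def by (intro exI[of _ "\<lambda>_. 1"]) simp
      then show "\<Phi> 0 {v} * of_bool (hits_subspace y 0 {v}) = \<phi> c0 {v}"
        by (simp add: \<Phi>_def h0)
    qed
    also have "\<dots> = bdry E (\<phi> c0) {}" by (simp add: bdry_def)
    also have "\<dots> = 1" using c0 by (simp add: chain_map_at_def)
    finally show ?case .
  next
    case (Suc k)
    have "(\<Sum>T\<in>Pow E. \<Phi> (Suc k) T * of_bool (hits_subspace y (Suc k) T)) =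
        (\<Sum>J\<in>Pow E. bdry E (\<Phi> (Suc k)) J * of_bool (hits_halfspace y k J))"
      using supp[OF _ Suc.prems] by (intro sum_bdry_hits[OF gp, symmetric]) auto
    also have "\<dots> = (\<Sum>J\<in>Pow E. (\<Phi> k J + \<Phi> k (\<nu> ` J)) * of_bool (hits_halfspace y k J))"
      using bdry_\<Phi>[OF Suc.prems] by (intro sum.cong) auto
    also have "\<dots> = (\<Sum>T\<in>Pow E. \<Phi> k T * of_bool (hits_subspace y k T))"
      using supp[of k] Suc.prems by (intro sum_hits_split[OF odd gp, symmetric]) auto
    also have "\<dots> = 1" using Suc by simp
    finally show ?case .
  qed
  obtain T where T: "\<Phi> d T * of_bool (hits_subspace y d T) \<noteq> 0"
  proof -
    have "(\<Sum>T\<in>Pow E. \<Phi> d T * of_bool (hits_subspace y d T)) \<noteq> 0" using one[of d] by simp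
    then show ?thesis using that by (rule sum.not_neutral_contains_not_neutral)
  qed
  then have T: "\<Phi> d T \<noteq> 0" "hits_subspace y d T" by (auto split: if_splits)
  obtain c where c: "c \<in> hemisphere N d" "\<phi> c T \<noteq> 0"
    using T(1) unfolding \<Phi>_def by (rule sum.not_neutral_contains_not_neutral)
  have "T \<in> M \<and> T \<subseteq> B c \<and> card T = Suc d"
    using hemi[OF c(1) order_refl] c(2) unfolding chain_map_at_def by metis
  then show ?thesis using T(2) hemi(1)[OF c(1) order_refl] by blast
qed

end

section \<open>Labels that hold on a cell\<close>

lemma common_convergent_subsequence:
  fixes f :: "nat \<Rightarrow> 'i \<Rightarrow> real"
  assumes "finite I" "\<And>n i. i \<in> I \<Longrightarrow> \<bar>f n i\<bar> \<le> K"
  shows "\<exists>r l. strict_mono (r :: nat \<Rightarrow> nat) \<and> (\<forall>i\<in>I. (\<lambda>n. f (r n) i) \<longlonglongrightarrow> l i)"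
  using assms
proof (induction I)
  case empty
  then show ?case by (intro exI[of _ id]) (simp add: strict_mono_def)
next
  case (insert i I)
  have "\<exists>r l. strict_mono (r :: nat \<Rightarrow> nat) \<and> (\<forall>j\<in>I. (\<lambda>n. f (r n) j) \<longlonglongrightarrow> l j)"
    using insert.prems by (intro insert.IH) simp
  then obtain r l where r: "strict_mono (r :: nat \<Rightarrow> nat)" "\<forall>j\<in>I. (\<lambda>n. f (r n) j) \<longlonglongrightarrow> l j"
    by (elim exE conjE)
  have "\<forall>n. f (r n) i \<in> {-K..K}" using insert.prems[of i] by (simp add: abs_le_iff minus_le_iff)
  with compact_Icc[of "-K" K, unfolded compact_def, rule_format, of "\<lambda>n. f (r n) i"]
  obtain x s where s: "strict_mono (s :: nat \<Rightarrow> nat)" "((\<lambda>n. f (r n) i) \<circ> s) \<longlonglongrightarrow> x"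
    by auto
  have "(\<lambda>n. f (r (s n)) j) \<longlonglongrightarrow> (l(i := x)) j" if "j \<in> insert i I" for j
  proof (cases "j = i")
    case True
    then show ?thesis using s(2) by (simp add: o_def)
  next
    case False
    then have "(\<lambda>n. f (r n) j) \<longlonglongrightarrow> l j" using r(2) that by blast
    from LIMSEQ_subseq_LIMSEQ[OF this s(1)] show ?thesis using False by (simp add: o_def)
  qed
  moreover have "strict_mono (\<lambda>n. r (s n))" using r(1) s(1) by (simp add: strict_mono_def)
  ultimately show ?case by blast
qed

text \<open>A label \<open>(w, i, s)\<close> gets the vector of \<open>(w, i)\<close> with its sign. The vectors of \<open>(w, i, True)\<close> and
  \<open>(w, i, False)\<close> are dependent, which is why the projection has to be injective on \<open>T\<close>.\<close>

lemma general_position_signed: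
  fixes Y :: "'q \<Rightarrow> nat \<Rightarrow> real" and \<sigma> :: "'v \<Rightarrow> real"
  assumes gp: "general_position Y P" and \<pi>: "\<pi> ` T \<subseteq> P" "inj_on \<pi> T"
    and \<sigma>: "\<And>v. v \<in> T \<Longrightarrow> \<sigma> v \<noteq> 0"
  shows "general_position (\<lambda>v a. \<sigma> v * Y (\<pi> v) a) T"
  unfolding general_position_def
proof (intro allI impI ballI)
  fix S l v assume S: "S \<subseteq> T" and l: "\<forall>a<card S. (\<Sum>v\<in>S. l v * (\<sigma> v * Y (\<pi> v) a)) = 0" and v: "v \<in> S"
  have inj: "inj_on \<pi> S" using \<pi>(2) S inj_on_subset by blast
  define m where "m q = l (the_inv_into S \<pi> q) * \<sigma> (the_inv_into S \<pi> q)" for q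
  have m: "m (\<pi> v) = l v * \<sigma> v" if "v \<in> S" for v
    unfolding m_def using the_inv_into_f_f[OF inj that] by simp
  have "(\<Sum>q\<in>\<pi> ` S. m q * Y q a) = (\<Sum>v\<in>S. l v * (\<sigma> v * Y (\<pi> v) a))" for a
    unfolding sum.reindex[OF inj] using m by (intro sum.cong) (auto simp: mult.assoc)
  then have "m (\<pi> v) = 0"
    using general_positionD[OF gp, of "\<pi> ` S" "card S" m "\<pi> v"] S \<pi>(1) l v card_image[OF inj] by auto
  then show "l v = 0" using m[OF v] \<sigma> S v by auto
qed

lemma matroid_parallel_extension:
  assumes W: "matroid W M" and E: "finite E"
  shows "matroid E {J. J \<subseteq> E \<and> inj_on f J \<and> f ` J \<in> M}"
  unfolding matroid_def
proof (intro conjI ballI allI impI)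
  fix I J assume I: "I \<in> {J. J \<subseteq> E \<and> inj_on f J \<and> f ` J \<in> M}" and J: "J \<subseteq> I"
  then have "f ` J \<in> M" using matroid_subset[OF W, of "f ` I" "f ` J"] by blast
  then show "J \<in> {J. J \<subseteq> E \<and> inj_on f J \<and> f ` J \<in> M}"
    using I J inj_on_subset by blast
next
  fix I J assume I: "I \<in> {J. J \<subseteq> E \<and> inj_on f J \<and> f ` J \<in> M}"
    and J: "J \<in> {J. J \<subseteq> E \<and> inj_on f J \<and> f ` J \<in> M}" and less: "card I < card J"
  then have "card (f ` I) < card (f ` J)" by (simp add: card_image)
  then obtain e where e: "e \<in> f ` J - f ` I" "insert e (f ` I) \<in> M"
    using matroid_exchange[OF W, of "f ` I" "f ` J"] I J by blast
  then obtain v where v: "v \<in> J" "f v = e" by blast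
  then have "v \<notin> I" using e(1) by blast
  moreover have "insert v I \<in> {J. J \<subseteq> E \<and> inj_on f J \<and> f ` J \<in> M}"
    using I J v e by auto
  ultimately show "\<exists>e\<in>J - I. insert e I \<in> {J. J \<subseteq> E \<and> inj_on f J \<and> f ` J \<in> M}"
    using v(1) by blast
next
  have "{} \<in> M" using W by (simp add: matroid_def)
  then show "{} \<in> {J. J \<subseteq> E \<and> inj_on f J \<and> f ` J \<in> M}" by simp
qed (use E in auto)

text \<open>The geometric cell, of which \<open>c\<close> is the code.\<close>

definition cell_body :: "(nat \<Rightarrow> int) \<Rightarrow> (nat \<Rightarrow> real) set"
  where "cell_body c = {u. \<forall>i. \<bar>u i - of_int (c i)\<bar> \<le> of_bool (odd (c i))}"

text \<open>Central projection from the boundary of the cube to the sphere.\<close>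

definition radial :: "nat \<Rightarrow> (nat \<Rightarrow> real) \<Rightarrow> nat \<Rightarrow> real"
  where "radial d u = (\<lambda>i. u i / sqrt (\<Sum>j\<le>d. (u j)\<^sup>2))"

definition signed :: "bool \<Rightarrow> (nat \<Rightarrow> real) \<Rightarrow> nat \<Rightarrow> real"
  where "signed s x = (if s then x else - x)"

lemma radial_in_nsphere:
  assumes "\<And>i. d < i \<Longrightarrow> u i = 0" "(\<Sum>j\<le>d. (u j)\<^sup>2) > 0"
  shows "radial d u \<in> topspace (nsphere d)"
proof -
  have "(\<Sum>i\<le>d. (radial d u i)\<^sup>2) = (\<Sum>i\<le>d. (u i)\<^sup>2) / (\<Sum>j\<le>d. (u j)\<^sup>2)"
    using assms(2) by (simp add: radial_def power_divide flip: sum_divide_distrib)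
  then show ?thesis using assms by (simp add: nsphere radial_def)
qed

lemma radial_scale:
  assumes "0 < N"
  shows "radial d (\<lambda>i. u i / N) = radial d u"
proof -
  have "sqrt (\<Sum>j\<le>d. (u j / N)\<^sup>2) = sqrt (\<Sum>j\<le>d. (u j)\<^sup>2) / N"
    using assms by (simp add: power_divide real_sqrt_divide flip: sum_divide_distrib)
  then show ?thesis using assms by (simp add: radial_def fun_eq_iff)
qed

lemma radial_uminus: "radial d (- u) = - radial d u"
  by (simp add: radial_def fun_eq_iff)

lemma cell_body_uminus: "u \<in> cell_body (- c) \<longleftrightarrow> - u \<in> cell_body c"
proof -
  have "\<bar>u i - of_int ((- c) i)\<bar> = \<bar>(- u) i - of_int (c i)\<bar>" for i
    by simp
  then show ?thesis by (simp add: cell_body_def)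
qed

lemma cell_body_face: "p \<in> flags c \<Longrightarrow> cell_body (face c p) \<subseteq> cell_body c"
proof
  fix u assume p: "p \<in> flags c" and u: "u \<in> cell_body (face c p)"
  obtain j s where js: "p = (j, s)" "odd (c j)" "s = 1 \<or> s = -1"
    using p by (auto simp: flags_def odds_def)
  have "\<bar>u i - of_int (c i)\<bar> \<le> of_bool (odd (c i))" for i
  proof (cases "i = j")
    case True
    have "\<bar>u j - of_int ((face c p) j)\<bar> \<le> of_bool (odd ((face c p) j))"
      using u unfolding cell_body_def by blast
    then have "u j = of_int (c j + s)" using js by auto
    then show ?thesis using True js by auto
  next
    case False
    have "\<bar>u i - of_int ((face c p) i)\<bar> \<le> of_bool (odd ((face c p) i))"
      using u unfolding cell_body_def by blast
    then show ?thesis using False js(1) by simp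
  qed
  then show "u \<in> cell_body c" by (simp add: cell_body_def)
qed

lemma cell_center: "(\<lambda>i. of_int (c i)) \<in> cell_body c"
  by (simp add: cell_body_def)

lemma sum_squares_cell_ge:
  assumes "c \<in> sphere_cells d N" "0 < N"
  shows "(\<Sum>j\<le>d. (of_int (c j) / of_int N :: real)\<^sup>2) \<ge> 1"
proof -
  obtain i where i: "\<bar>c i\<bar> = N" using assms(1) by (auto simp: sphere_cells_def)
  have "i \<le> d" using assms i by (auto simp: sphere_cells_def) (metis abs_zero linorder_not_le order_less_irrefl)
  have "(of_int (c i) / of_int N :: real)\<^sup>2 = (of_int \<bar>c i\<bar> / of_int N)\<^sup>2"
    by (simp add: power_divide)
  also have "\<dots> = 1" using i assms(2) by simp
  finally have "1 = (of_int (c i) / of_int N :: real)\<^sup>2" by simp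
  also have "\<dots> \<le> (\<Sum>j\<le>d. (of_int (c j) / of_int N)\<^sup>2)"
    using \<open>i \<le> d\<close> by (intro member_le_sum) auto
  finally show ?thesis .
qed

text \<open>The sets that cover the sphere. The vectors attached to the labels are a parameter \<open>Y\<close> of the results
  about them, to be built from the points \<open>X\<close> at the very end.\<close>

locale matroid_colored_cover =
  fixes d m :: nat and W :: "'w set" and M :: "'w set set" and A :: "'w \<Rightarrow> nat \<Rightarrow> (nat \<Rightarrow> real) set"
  assumes M: "matroid W M"
    and closed_A: "\<And>w i. w \<in> W \<Longrightarrow> i \<in> {1..m} \<Longrightarrow> closedin (nsphere d) (A w i)"
    and covers: "\<And>W'. W' \<subseteq> W \<Longrightarrow> matroid_rank M (W - W') \<le> d \<Longrightarrow>
           topspace (nsphere d) = (\<Union>w\<in>W'. \<Union>i\<in>{1..m}. A w i \<union> uminus ` A w i)"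
begin

definition labels :: "('w \<times> nat \<times> bool) set"
  where "labels = W \<times> {1..m} \<times> UNIV"

definition indep :: "('w \<times> nat \<times> bool) set set"
  where "indep = {J. J \<subseteq> labels \<and> inj_on fst J \<and> fst ` J \<in> M}"

definition flip :: "'w \<times> nat \<times> bool \<Rightarrow> 'w \<times> nat \<times> bool"
  where "flip v = (fst v, fst (snd v), \<not> snd (snd v))"

definition sign :: "'w \<times> nat \<times> bool \<Rightarrow> real"
  where "sign v = (if snd (snd v) then 1 else -1)"

definition holds :: "(nat \<Rightarrow> real) \<Rightarrow> 'w \<times> nat \<times> bool \<Rightarrow> bool"
  where "holds x v \<longleftrightarrow> signed (snd (snd v)) x \<in> A (fst v) (fst (snd v))"

definition cell_labels :: "(nat \<Rightarrow> int) \<Rightarrow> ('w \<times> nat \<times> bool) set"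
  where "cell_labels c = {v\<in>labels. \<exists>u\<in>cell_body c. holds (radial d u) v}"

lemma finite_W: "finite W" and empty_M: "{} \<in> M"
  using M by (simp_all add: matroid_def)

lemma finite_M: "finite M"
  using M finite_W by (intro finite_subset[of M "Pow W"]) (simp_all add: matroid_def)

lemma finite_labels: "finite labels"
  using finite_W by (simp add: labels_def)

lemma fst_flip [simp]: "fst (flip v) = fst v" and flip_flip [simp]: "flip (flip v) = v"
  and flip_in_labels: "v \<in> labels \<Longrightarrow> flip v \<in> labels" and sign_flip: "sign (flip v) = - sign v"
  by (auto simp: flip_def labels_def sign_def)

lemma holds_uminus: "holds (- x) v \<longleftrightarrow> holds x (flip v)"
  by (simp add: holds_def flip_def signed_def)

lemma matroid_indep: "matroid labels indep"
  unfolding indep_def using M finite_labels by (rule matroid_parallel_extension)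

text \<open>If the \<open>w\<close> with a label that holds at \<open>x\<close> had rank at most \<open>d\<close>, then the sets of
  the remaining \<open>w\<close> would cover \<open>x\<close>, although none of their labels holds there.\<close>

lemma holds_rank:
  assumes x: "x \<in> topspace (nsphere d)"
  shows "\<exists>J\<in>indep. d < card J \<and> (\<forall>v\<in>J. holds x v)"
proof -
  define T where "T = {w\<in>W. \<exists>i\<in>{1..m}. x \<in> A w i \<union> uminus ` A w i}"
  have "d < matroid_rank M T"
  proof (rule ccontr)
    assume "\<not> ?thesis"
    then have "matroid_rank M (W - (W - T)) \<le> d"
      by (simp add: double_diff T_def)
    from covers[OF _ this] x have "x \<in> (\<Union>w\<in>W - T. \<Union>i\<in>{1..m}. A w i \<union> uminus ` A w i)"
      by auto
    then show False by (auto simp: T_def)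
  qed
  moreover have "matroid_rank M T \<in> card ` {I\<in>M. I \<subseteq> T}"
    unfolding matroid_rank_def using finite_M empty_M by (intro Max_in) auto
  ultimately obtain I where I: "I \<in> M" "I \<subseteq> T" "d < card I" by auto
  have "\<forall>w\<in>I. \<exists>v. v \<in> labels \<and> fst v = w \<and> holds x v"
  proof
    fix w assume "w \<in> I"
    then obtain i where i: "w \<in> W" "i \<in> {1..m}" "x \<in> A w i \<union> uminus ` A w i"
      using I(2) by (auto simp: T_def)
    then have "holds x (w, i, True) \<or> holds x (w, i, False)"
      by (auto simp: holds_def signed_def)
    then show "\<exists>v. v \<in> labels \<and> fst v = w \<and> holds x v"
      using i(1,2) by (auto simp: labels_def)
  qed
  from bchoice[OF this] obtain g where g: "\<And>w. w \<in> I \<Longrightarrow> g w \<in> labels \<and> fst (g w) = w \<and> holds x (g w)"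
    by blast
  have "inj_on g I" using g by (metis inj_onI)
  then have "card (g ` I) = card I" by (rule card_image)
  moreover have "fst ` g ` I = I" using g by force
  moreover have "inj_on fst (g ` I)" using g by (auto simp: inj_on_def)
  ultimately show ?thesis using I g by (intro bexI[of _ "g ` I"]) (auto simp: indep_def)
qed

text \<open>General position makes \<open>antipodal_zero\<close> applicable, at the price of an error that is at most the
  size of the perturbation.\<close>

lemma near_zero:
  fixes Y :: "'w \<times> nat \<Rightarrow> nat \<Rightarrow> real"
  assumes N: "even N" "0 < N" and "0 < \<delta>"
  shows "\<exists>c\<in>sphere_cells d N. \<exists>J\<in>indep. \<exists>l. J \<subseteq> cell_labels c \<and> card J = Suc d \<and>
    (\<forall>v\<in>J. 0 \<le> l v) \<and> sum l J = 1 \<and>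
    (\<forall>a<d. \<bar>\<Sum>v\<in>J. l v * (sign v * Y (fst v, fst (snd v)) a)\<bar> \<le> \<delta>)"
proof -
  have "finite (W \<times> {1..m})" using finite_W by simp
  then obtain Y' where Y': "\<forall>q\<in>W \<times> {1..m}. \<forall>a. \<bar>Y' q a - Y q a\<bar> \<le> \<delta>" "general_position Y' (W \<times> {1..m})"
    using general_position_perturb[of _ \<delta> Y] assms(3) by blast
  define y where "y v a = sign v * Y' (fst v, fst (snd v)) a" for v a
  interpret antipodal_carrier labels indep flip cell_labels d N
  proof unfold_locales
    fix J assume J: "J \<in> indep"
    have "inj_on fst (flip ` J)" "fst ` flip ` J = fst ` J"
      using J by (auto simp: indep_def inj_on_def image_image)
    then show "flip ` J \<in> indep"
      using J flip_in_labels by (auto simp: indep_def)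
  next
    fix c assume c: "c \<in> sphere_cells d N"
    show "cell_labels c \<subseteq> labels" by (auto simp: cell_labels_def)
    show "cell_labels (face c p) \<subseteq> cell_labels c" if "p \<in> flags c" for p
      using cell_body_face[OF that] by (auto simp: cell_labels_def)
    have sub: "flip v \<in> cell_labels (- c)" if v: "v \<in> cell_labels c" for c v
    proof -
      obtain u where u: "u \<in> cell_body c" "holds (radial d u) v" and vl: "v \<in> labels"
        using v unfolding cell_labels_def by blast
      have "- u \<in> cell_body (- c)" using u(1) by (simp add: cell_body_uminus)
      moreover have "holds (radial d (- u)) (flip v)"
        using u(2) by (simp add: radial_uminus holds_uminus)
      ultimately show ?thesis using flip_in_labels[OF vl] by (auto simp: cell_labels_def)
    qed
    show "cell_labels (- c) = flip ` cell_labels c"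
    proof
      show "flip ` cell_labels c \<subseteq> cell_labels (- c)" using sub by blast
      show "cell_labels (- c) \<subseteq> flip ` cell_labels c"
      proof
        fix v assume "v \<in> cell_labels (- c)"
        then have "flip v \<in> cell_labels c" using sub[of v "- c"] by simp
        then show "v \<in> flip ` cell_labels c" by (metis flip_flip image_eqI)
      qed
    qed
    let ?u = "\<lambda>i. of_int (c i) :: real"
    have "0 < (\<Sum>j\<le>d. (?u j)\<^sup>2)"
    proof -
      have "1 \<le> (\<Sum>j\<le>d. (?u j)\<^sup>2) / (of_int N)\<^sup>2"
        using sum_squares_cell_ge[OF c N(2)] by (simp add: power_divide sum_divide_distrib)
      moreover have "0 < (of_int N :: real)\<^sup>2" using N(2) by simp
      ultimately have "(of_int N)\<^sup>2 \<le> (\<Sum>j\<le>d. (?u j)\<^sup>2)" by (simp add: le_divide_eq)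
      with \<open>0 < (of_int N :: real)\<^sup>2\<close> show ?thesis by linarith
    qed
    then have "radial d ?u \<in> topspace (nsphere d)"
      using c by (intro radial_in_nsphere) (auto simp: sphere_cells_def)
    then obtain J where J: "J \<in> indep" "d < card J" "\<forall>v\<in>J. holds (radial d ?u) v"
      using holds_rank by blast
    then have "J \<subseteq> cell_labels c"
      using cell_center[of c] by (auto simp: cell_labels_def indep_def)
    then show "\<exists>I\<in>indep. I \<subseteq> cell_labels c \<and> d < card I" using J by blast
  qed (simp_all add: matroid_indep N flip_in_labels)
  have "\<exists>c\<in>sphere_cells d N. \<exists>J\<in>indep. J \<subseteq> cell_labels c \<and> card J = Suc d \<and> hits_subspace y d J"
  proof (rule antipodal_zero)
    show "y (flip v) a = - y v a" if "v \<in> labels" for v a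
      by (simp add: y_def sign_flip) (simp add: flip_def)
    fix J assume J: "J \<in> indep"
    show "general_position y J"
      unfolding y_def
    proof (rule general_position_signed[OF Y'(2), where \<pi> = "\<lambda>v. (fst v, fst (snd v))"])
      show "(\<lambda>v. (fst v, fst (snd v))) ` J \<subseteq> W \<times> {1..m}" "inj_on (\<lambda>v. (fst v, fst (snd v))) J"
        using J by (auto simp: indep_def labels_def inj_on_def)
    qed (simp add: sign_def)
  qed
  then obtain c J l where c: "c \<in> sphere_cells d N" and J: "J \<in> indep" "J \<subseteq> cell_labels c" "card J = Suc d"
    and l: "\<forall>v\<in>J. 0 \<le> l v" "\<exists>v\<in>J. l v \<noteq> 0" "\<forall>a<d. (\<Sum>v\<in>J. l v * y v a) = 0"
    unfolding hits_subspace_def by blast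
  have finJ: "finite J" using J(3) by (metis card.infinite nat.distinct(1))
  define r where "r = sum l J"
  have "0 < r" unfolding r_def
    using l(1,2) finJ by (metis less_eq_real_def sum_nonneg sum_nonneg_eq_0_iff)
  define l' where "l' v = l v / r" for v
  have l': "\<forall>v\<in>J. 0 \<le> l' v" "sum l' J = 1"
    using l(1) \<open>0 < r\<close> by (auto simp: l'_def r_def simp flip: sum_divide_distrib)
  have "\<bar>\<Sum>v\<in>J. l' v * (sign v * Y (fst v, fst (snd v)) a)\<bar> \<le> \<delta>" if a: "a < d" for a
  proof -
    have "(\<Sum>v\<in>J. l' v * y v a) = (\<Sum>v\<in>J. l v * y v a) / r"
      by (simp add: l'_def sum_divide_distrib)
    then have "(\<Sum>v\<in>J. l' v * y v a) = 0" using l(3) a by simp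
    then have "\<bar>\<Sum>v\<in>J. l' v * (sign v * Y (fst v, fst (snd v)) a)\<bar> =
        \<bar>\<Sum>v\<in>J. l' v * (sign v * Y (fst v, fst (snd v)) a - y v a)\<bar>"
      by (simp add: right_diff_distrib sum_subtractf)
    also have "\<dots> \<le> (\<Sum>v\<in>J. \<bar>l' v * (sign v * Y (fst v, fst (snd v)) a - y v a)\<bar>)"
      by (rule sum_abs)
    also have "\<dots> \<le> (\<Sum>v\<in>J. l' v * \<delta>)"
    proof (rule sum_mono)
      fix v assume v: "v \<in> J"
      then have "(fst v, fst (snd v)) \<in> W \<times> {1..m}" using J(1) by (auto simp: indep_def labels_def)
      then have "\<bar>Y' (fst v, fst (snd v)) a - Y (fst v, fst (snd v)) a\<bar> \<le> \<delta>" using Y'(1) by blast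
      then have "\<bar>sign v * Y (fst v, fst (snd v)) a - y v a\<bar> \<le> \<delta>"
        by (auto simp: y_def sign_def abs_minus_commute)
      then show "\<bar>l' v * (sign v * Y (fst v, fst (snd v)) a - y v a)\<bar> \<le> l' v * \<delta>"
        using l'(1) v by (simp add: abs_mult mult_left_mono)
    qed
    also have "\<dots> = \<delta>" using l'(2) by (simp flip: sum_distrib_right)
    finally show ?thesis .
  qed
  then show ?thesis using c J l' by blast
qed

lemma holds_limit:
  assumes v: "v \<in> labels" and x: "x \<in> topspace (nsphere d)"
    and X: "\<And>n. holds (X n) v" and lim: "\<And>a. (\<lambda>n. X n a) \<longlonglongrightarrow> x a"
  shows "holds x v"
proof -
  have cl: "closedin (nsphere d) (A (fst v) (fst (snd v)))"
    using v by (intro closed_A) (auto simp: labels_def)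
  have lim': "(\<lambda>n. signed (snd (snd v)) (X n) a) \<longlonglongrightarrow> signed (snd (snd v)) x a" for a
    using lim[of a] by (auto simp: signed_def intro!: tendsto_minus)
  have mem: "signed (snd (snd v)) (X n) \<in> A (fst v) (fst (snd v))" for n
    using X[of n] by (simp add: holds_def)
  have sx: "signed (snd (snd v)) x \<in> topspace (nsphere d)"
    using x by (auto simp: signed_def nsphere)
  have sub: "A (fst v) (fst (snd v)) \<subseteq> topspace (nsphere d)" using cl closedin_subset by blast
  have "limitin (nsphere d) (\<lambda>n. signed (snd (snd v)) (X n)) (signed (snd (snd v)) x) sequentially"
  proof -
    have "\<forall>n. signed (snd (snd v)) (X n) \<in> topspace (nsphere d)" using mem sub by (meson subsetD)
    then show ?thesis
      using lim' sx by (simp add: nsphere limitin_subtopology limitin_componentwise)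
  qed
  then show ?thesis
    unfolding holds_def using mem cl
    by (intro limitin_closedin[where X = "nsphere d" and F = sequentially]) auto
qed

section \<open>Passage to the limit\<close>

text \<open>Let the mesh and the perturbation tend to 0. Some label set \<open>J0\<close> recurs infinitely often, and along a
  subsequence the centres of the rescaled cells and the coefficients converge. The points that
  witness the labels of \<open>J0\<close> lie in a common cell, so after projection all of them tend to one point.\<close>

theorem exact_zero:
  fixes Y :: "'w \<times> nat \<Rightarrow> nat \<Rightarrow> real"
  shows "\<exists>x\<in>topspace (nsphere d). \<exists>J\<in>indep. \<exists>l. card J = Suc d \<and> (\<forall>v\<in>J. holds x v) \<and>
    (\<forall>v\<in>J. 0 \<le> l v) \<and> sum l J = 1 \<and> (\<forall>a<d. (\<Sum>v\<in>J. l v * (sign v * Y (fst v, fst (snd v)) a)) = 0)"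
proof -
  \<comment> \<open>after rescaling by \<open>1 / N n\<close>, cells have diameter at most \<open>1 / (n + 1)\<close> in each coordinate\<close>
  define N where "N n = 2 * (int n + 1)" for n
  have N: "even (N n)" "0 < N n" for n by (auto simp: N_def)
  define approx where "approx n c J l \<longleftrightarrow> c \<in> sphere_cells d (N n) \<and> J \<in> indep \<and> J \<subseteq> cell_labels c \<and>
    card J = Suc d \<and> (\<forall>v\<in>J. 0 \<le> l v) \<and> sum l J = 1 \<and>
    (\<forall>a<d. \<bar>\<Sum>v\<in>J. l v * (sign v * Y (fst v, fst (snd v)) a)\<bar> \<le> inverse (real (Suc n)))" for n c J l
  have "\<forall>n. \<exists>c J l. approx n c J l"
  proof
    fix n
    have "0 < inverse (real (Suc n))" by simp
    from near_zero[OF N this, of n Y] show "\<exists>c J l. approx n c J l"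
      unfolding approx_def by blast
  qed
  from choice[OF this] obtain c where "\<forall>n. \<exists>J l. approx n (c n) J l" ..
  from choice[OF this] obtain J where "\<forall>n. \<exists>l. approx n (c n) (J n) l" ..
  from choice[OF this] obtain l where cJl: "\<forall>n. approx n (c n) (J n) (l n)" ..
  have c: "c n \<in> sphere_cells d (N n)"
    and J: "J n \<in> indep" "J n \<subseteq> cell_labels (c n)" "card (J n) = Suc d"
    and l: "v \<in> J n \<Longrightarrow> 0 \<le> l n v" "sum (l n) (J n) = 1"
      "a < d \<Longrightarrow> \<bar>\<Sum>v\<in>J n. l n v * (sign v * Y (fst v, fst (snd v)) a)\<bar> \<le> inverse (real (Suc n))"
    for n v a
    using cJl[rule_format, of n] unfolding approx_def by simp_all
  \<comment> \<open>there are only finitely many label sets, so one of them recurs\<close>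
  have "range J \<subseteq> Pow labels" using J(1) by (auto simp: indep_def)
  then have "finite (range J)" using finite_labels finite_subset by blast
  then obtain n0 where "infinite {n. J n = J n0}"
    using pigeonhole_infinite[of "UNIV :: nat set" J] by auto
  from infinite_enumerate[OF this]
  obtain r0 where r0: "strict_mono (r0 :: nat \<Rightarrow> nat)" "\<And>n. J (r0 n) = J n0"
    by auto
  define J0 where "J0 = J n0"
  have finJ: "finite J0" using J(1)[of n0] finite_labels finite_subset by (auto simp: J0_def indep_def)
  \<comment> \<open>the quantities that have to converge together, as one finite family\<close>
  define f where "f n k = (case k of Inl a \<Rightarrow> of_int (c (r0 n) a) / of_int (N (r0 n)) | Inr v \<Rightarrow> l (r0 n) v)"
    for n :: nat and k
  have bound: "\<bar>f n k\<bar> \<le> 1" if "k \<in> Inl ` {..d} \<union> Inr ` J0" for n k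
  proof (cases k)
    case (Inl a)
    have "\<bar>c (r0 n) a\<bar> \<le> N (r0 n)" using c[of "r0 n"] by (auto simp: sphere_cells_def)
    then have "real_of_int \<bar>c (r0 n) a\<bar> \<le> real_of_int (N (r0 n))" by (rule of_int_le_iff[THEN iffD2])
    then show ?thesis using N(2)[of "r0 n"] by (simp add: f_def Inl abs_divide)
  next
    case (Inr v)
    then have v: "v \<in> J (r0 n)" using that r0(2) by (auto simp: J0_def)
    have "l (r0 n) v \<le> sum (l (r0 n)) (J (r0 n))"
      using v l(1) finJ r0(2) by (intro member_le_sum) (auto simp: J0_def)
    then show ?thesis using l(1)[OF v] l(2) by (simp add: f_def Inr)
  qed
  have "finite (Inl ` {..d} \<union> Inr ` J0)" using finJ by simp
  then have "\<exists>r L. strict_mono (r :: nat \<Rightarrow> nat) \<and>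
      (\<forall>k\<in>Inl ` {..d} \<union> Inr ` J0. (\<lambda>n. f (r n) k) \<longlonglongrightarrow> L k)"
    by (rule common_convergent_subsequence) (rule bound)
  then obtain r1 L where r1: "strict_mono (r1 :: nat \<Rightarrow> nat)"
    and L: "\<forall>k\<in>Inl ` {..d} \<union> Inr ` J0. (\<lambda>n. f (r1 n) k) \<longlonglongrightarrow> L k"
    by (elim exE conjE)
  define q where "q n = r0 (r1 n)" for n
  have q: "strict_mono q" "\<And>n. J (q n) = J0"
    using r0 r1 by (auto simp: q_def strict_mono_def J0_def)
  define u where "u a = (if a \<le> d then L (Inl a) else 0)" for a
  have u: "(\<lambda>n. of_int (c (q n) a) / of_int (N (q n))) \<longlonglongrightarrow> u a" for a
  proof (cases "a \<le> d")
    case True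
    then show ?thesis using L[rule_format, of "Inl a"] by (simp add: f_def q_def u_def)
  next
    case False
    then have "c (q n) a = 0" for n using c[of "q n"] by (auto simp: sphere_cells_def)
    then show ?thesis using False by (simp add: u_def)
  qed
  have lim_l: "(\<lambda>n. l (q n) v) \<longlonglongrightarrow> L (Inr v)" if "v \<in> J0" for v
    using L[rule_format, of "Inr v"] that by (simp add: f_def q_def)
  have inv0: "(\<lambda>n. inverse (real (Suc (q n)))) \<longlonglongrightarrow> 0"
    using LIMSEQ_subseq_LIMSEQ[OF LIMSEQ_inverse_real_of_nat q(1)] by (simp add: o_def)
  have "(\<lambda>n. \<Sum>j\<le>d. (of_int (c (q n) j) / of_int (N (q n)) :: real)\<^sup>2) \<longlonglongrightarrow> (\<Sum>j\<le>d. (u j)\<^sup>2)"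
    by (intro tendsto_sum tendsto_power u)
  then have u_pos: "1 \<le> (\<Sum>j\<le>d. (u j)\<^sup>2)"
    using sum_squares_cell_ge[OF c N(2)] by (intro LIMSEQ_le_const) auto
  define x where "x = radial d u"
  have x: "x \<in> topspace (nsphere d)"
    unfolding x_def using u_pos by (intro radial_in_nsphere) (auto simp: u_def)
  have "holds x v" if v: "v \<in> J0" for v
  proof -
    have "v \<in> labels" using v J(1)[of n0] by (auto simp: J0_def indep_def)
    have "\<forall>n. \<exists>t. t \<in> cell_body (c (q n)) \<and> holds (radial d t) v"
      using J(2) q(2) v unfolding cell_labels_def by blast
    then obtain U where U: "\<And>n. U n \<in> cell_body (c (q n))" "\<And>n. holds (radial d (U n)) v"
      by metis
    define V where "V n a = U n a / of_int (N (q n))" for n a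
    have V: "(\<lambda>n. V n a) \<longlonglongrightarrow> u a" for a
    proof -
      have "(\<lambda>n. V n a - of_int (c (q n) a) / of_int (N (q n))) \<longlonglongrightarrow> 0"
      proof (rule tendsto_rabs_zero_cancel, rule tendsto_sandwich[OF _ _ tendsto_const inv0])
        show "\<forall>\<^sub>F n in sequentially. \<bar>V n a - of_int (c (q n) a) / of_int (N (q n))\<bar> \<le> inverse (real (Suc (q n)))"
        proof (intro always_eventually allI)
          fix n
          have "\<bar>U n a - of_int (c (q n) a)\<bar> \<le> of_bool (odd (c (q n) a))"
            using U(1)[of n] unfolding cell_body_def by blast
          then have "\<bar>U n a - of_int (c (q n) a)\<bar> \<le> 1" by (simp split: if_splits add: of_bool_def)
          moreover have "V n a - of_int (c (q n) a) / of_int (N (q n)) = (U n a - of_int (c (q n) a)) / of_int (N (q n))"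
            by (simp add: V_def diff_divide_distrib)
          moreover have "real (Suc (q n)) \<le> of_int (N (q n))" by (simp add: N_def)
          ultimately show "\<bar>V n a - of_int (c (q n) a) / of_int (N (q n))\<bar> \<le> inverse (real (Suc (q n)))"
            using N(2)[of "q n"] by (simp add: abs_divide inverse_eq_divide frac_le)
        qed
      qed auto
      from tendsto_add[OF this u[of a]] show ?thesis by simp
    qed
    have "radial d (V n) = radial d (U n)" for n
      unfolding V_def using N(2)[of "q n"] by (intro radial_scale) simp
    moreover have "(\<lambda>n. radial d (V n) a) \<longlonglongrightarrow> x a" for a
      unfolding x_def radial_def using u_pos by (intro tendsto_intros V) auto
    ultimately have "(\<lambda>n. radial d (U n) a) \<longlonglongrightarrow> x a" for a by simp
    from holds_limit[where X = "\<lambda>n. radial d (U n)", OF \<open>v \<in> labels\<close> x U(2) this]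
    show ?thesis .
  qed
  moreover have "0 \<le> L (Inr v)" if v: "v \<in> J0" for v
  proof -
    have "0 \<le> l (q n) v" for n using l(1)[of v "q n"] q(2)[of n] v by simp
    then show ?thesis by (intro LIMSEQ_le_const[OF lim_l[OF v]]) blast
  qed
  moreover have "sum (\<lambda>v. L (Inr v)) J0 = 1"
  proof (rule LIMSEQ_unique)
    show "(\<lambda>n. sum (l (q n)) J0) \<longlonglongrightarrow> sum (\<lambda>v. L (Inr v)) J0"
      by (intro tendsto_sum lim_l)
    have "sum (l (q n)) J0 = 1" for n using l(2)[of "q n"] q(2) by simp
    then show "(\<lambda>n. sum (l (q n)) J0) \<longlonglongrightarrow> 1" by simp
  qed
  moreover have "(\<Sum>v\<in>J0. L (Inr v) * (sign v * Y (fst v, fst (snd v)) a)) = 0" if a: "a < d" for a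
  proof (rule LIMSEQ_unique)
    show "(\<lambda>n. \<Sum>v\<in>J0. l (q n) v * (sign v * Y (fst v, fst (snd v)) a)) \<longlonglongrightarrow>
        (\<Sum>v\<in>J0. L (Inr v) * (sign v * Y (fst v, fst (snd v)) a))"
      by (intro tendsto_sum tendsto_mult lim_l tendsto_const)
    show "(\<lambda>n. \<Sum>v\<in>J0. l (q n) v * (sign v * Y (fst v, fst (snd v)) a)) \<longlonglongrightarrow> 0"
    proof (rule tendsto_rabs_zero_cancel, rule tendsto_sandwich[OF _ _ tendsto_const inv0])
      have "\<bar>\<Sum>v\<in>J0. l (q n) v * (sign v * Y (fst v, fst (snd v)) a)\<bar> \<le> inverse (real (Suc (q n)))" for n
        using l(3)[OF a, of "q n"] q(2)[of n] by simp
      then show "\<forall>\<^sub>F n in sequentially. \<bar>\<Sum>v\<in>J0. l (q n) v * (sign v * Y (fst v, fst (snd v)) a)\<bar>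
          \<le> inverse (real (Suc (q n)))"
        by (intro always_eventually allI)
    qed simp
  qed
  moreover have "J0 \<in> indep" "card J0 = Suc d" using J by (simp_all add: J0_def)
  ultimately show ?thesis
    using x by (intro bexI[of _ x] bexI[of _ J0] exI[of _ "\<lambda>v. L (Inr v)"] conjI ballI allI impI)
qed

end

section \<open>The Radon partition\<close>
lemma sum_fun_apply: "(\<Sum>i\<in>S. f i) a = (\<Sum>i\<in>S. f i a)" for f :: "'i \<Rightarrow> 'a \<Rightarrow> real"
  by (induction S rule: infinite_finite_induct) auto

theorem corollary4:
  fixes d m :: nat
    and W :: "'w set"
    and M :: "'w set set"
    and X :: "'w \<Rightarrow> nat \<Rightarrow> (nat \<Rightarrow> real)"
    and A :: "'w \<Rightarrow> nat \<Rightarrow> (nat \<Rightarrow> real) set"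
  assumes "d \<ge> 1" and "m \<ge> 1"
    and "finite W"
    and "matroid W M"
    and "matroid_rank M W \<ge> d + 1"
    and "\<And>w i. w \<in> W \<Longrightarrow> i \<in> {1..m} \<Longrightarrow> X w i \<in> topspace (Euclidean_space (d - 1))"
    and "\<And>w i. w \<in> W \<Longrightarrow> i \<in> {1..m} \<Longrightarrow> closedin (nsphere d) (A w i)"
    and "\<And>W'. W' \<subseteq> W \<Longrightarrow> matroid_rank M (W - W') \<le> d \<Longrightarrow>
           topspace (nsphere d) = (\<Union>w\<in>W'. \<Union>i\<in>{1..m}. A w i \<union> uminus ` A w i)"
    and "\<And>u w i. u \<in> W \<Longrightarrow> w \<in> W \<Longrightarrow> {u, w} \<in> M \<Longrightarrow> i \<in> {1..m} \<Longrightarrow>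
           A u i \<inter> uminus ` A w i = {}"
  shows "\<exists>x \<in> topspace (nsphere d). \<exists>P Q.
           P \<subseteq> W \<times> {1..m} \<and> Q \<subseteq> W \<times> {1..m} \<and> P \<noteq> {} \<and> Q \<noteq> {} \<and> P \<inter> Q = {} \<and>
           convex hull ((\<lambda>(w, i). X w i) ` P) \<inter> convex hull ((\<lambda>(w, i). X w i) ` Q) \<noteq> {} \<and>
           x \<in> (\<Inter>(w, i)\<in>P. A w i) \<inter> (\<Inter>(w, i)\<in>Q. uminus ` A w i) \<and>
           inj_on fst (P \<union> Q) \<and> fst ` (P \<union> Q) \<in> M \<and> matroid_rank M (fst ` (P \<union> Q)) = d + 1 \<and>
           snd ` P \<inter> snd ` Q = {}"
proof -
  interpret matroid_colored_cover d m W M A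
    using assms(4,7,8) by unfold_locales
  \<comment> \<open>the constant coordinate \<open>d - 1\<close> turns linear relations into relations of equal total weight\<close>
  define Y where "Y q a = (if a < d - 1 then X (fst q) (snd q) a else 1)" for q and a :: nat
  obtain x J l where x: "x \<in> topspace (nsphere d)" and J: "J \<in> indep" "card J = Suc d"
    and hold: "\<And>v. v \<in> J \<Longrightarrow> holds x v" and l: "\<And>v. v \<in> J \<Longrightarrow> 0 \<le> l v" "sum l J = 1"
    and zero: "\<And>a. a < d \<Longrightarrow> (\<Sum>v\<in>J. l v * (sign v * Y (fst v, fst (snd v)) a)) = 0"
    using exact_zero[of Y] by blast
  have JE: "J \<subseteq> labels" and inj: "inj_on fst J" and JM: "fst ` J \<in> M"
    using J(1) by (auto simp: indep_def)
  have finJ: "finite J" using JE finite_labels finite_subset by blast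
  define part where "part s = {(w, i). (w, i, s) \<in> J}" for s
  define wt where "wt s q = l (fst q, snd q, s)" for s q
  have part_sub: "part s \<subseteq> W \<times> {1..m}" for s
    using JE by (auto simp: part_def labels_def)
  have fin: "finite (part s)" for s
    using part_sub finite_W finite_subset by (metis finite_SigmaI finite_atLeastAtMost)
  have wt_nonneg: "0 \<le> wt s q" if "q \<in> part s" for s q
    using that l(1) by (auto simp: part_def wt_def)
  have split: "(\<Sum>v\<in>J. h v) = (\<Sum>q\<in>part True. h (fst q, snd q, True)) + (\<Sum>q\<in>part False. h (fst q, snd q, False))"
    for h :: "'w \<times> nat \<times> bool \<Rightarrow> real"
  proof -
    define emb where "emb s q = (fst q, snd q, s)" for s :: bool and q :: "'w \<times> nat"
    have J_eq: "J = emb True ` part True \<union> emb False ` part False"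
    proof (intro equalityI subsetI)
      fix v assume "v \<in> J"
      then show "v \<in> emb True ` part True \<union> emb False ` part False"
        by (cases v; cases "snd (snd v)") (force simp: emb_def part_def)+
    qed (auto simp: emb_def part_def)
    have "inj_on (emb s) (part s)" for s by (auto simp: inj_on_def emb_def prod_eq_iff)
    then have "sum h (emb s ` part s) = (\<Sum>q\<in>part s. h (fst q, snd q, s))" for s
      by (simp add: sum.reindex) (simp add: emb_def)
    moreover have "emb True ` part True \<inter> emb False ` part False = {}" by (auto simp: emb_def)
    ultimately show ?thesis
      unfolding J_eq using fin by (subst sum.union_disjoint) simp_all
  qed
  define \<Lambda> where "\<Lambda> s = sum (wt s) (part s)" for s
  have tot: "\<Lambda> True + \<Lambda> False = 1"
    using l(2) split[of l] by (simp add: \<Lambda>_def wt_def)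
  have bal: "(\<Sum>q\<in>part True. wt True q * Y q a) = (\<Sum>q\<in>part False. wt False q * Y q a)" if "a < d" for a
    using zero[OF that] by (simp add: split sign_def wt_def sum_negf)
  have "\<Lambda> True = \<Lambda> False"
    using bal[of "d - 1"] assms(1) by (simp add: \<Lambda>_def Y_def)
  with tot have half: "\<Lambda> s = 1 / 2" for s by (cases s) auto
  have ne: "part s \<noteq> {}" for s using half[of s] by (auto simp: \<Lambda>_def)
  \<comment> \<open>each sign carries total weight \<open>1 / 2\<close>, so doubling normalises the weights\<close>
  define z where "z s = (\<Sum>q\<in>part s. (2 * wt s q) *\<^sub>R X (fst q) (snd q))" for s
  have z_hull: "z s \<in> convex hull ((\<lambda>(w, i). X w i) ` part s)" for s
    unfolding z_def
  proof (rule convex_sum[OF fin])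
    show "(\<Sum>q\<in>part s. 2 * wt s q) = 1"
      using half[of s] by (simp add: \<Lambda>_def flip: sum_distrib_left)
    show "X (fst q) (snd q) \<in> convex hull ((\<lambda>(w, i). X w i) ` part s)" if "q \<in> part s" for q
      using that by (intro hull_inc) (auto simp: case_prod_unfold)
  qed (use wt_nonneg in auto)
  have "z True = z False"
  proof
    fix a
    have z_a: "z s a = 2 * (\<Sum>q\<in>part s. wt s q * X (fst q) (snd q) a)" for s
      by (simp add: z_def sum_fun_apply scaleR_fun_def sum_distrib_left mult.assoc)
    show "z True a = z False a"
    proof (cases "a < d - 1")
      case True
      then show ?thesis using bal[of a] by (simp add: z_a Y_def)
    next
      case False
      then have "X (fst q) (snd q) a = 0" if "q \<in> part s" for s q
        using part_sub[of s] that assms(6) by (fastforce simp: topspace_Euclidean_space)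
      then show ?thesis by (simp add: z_a)
    qed
  qed
  then have hulls: "convex hull ((\<lambda>(w, i). X w i) ` part True) \<inter> convex hull ((\<lambda>(w, i). X w i) ` part False) \<noteq> {}"
    using z_hull[of True] z_hull[of False] by auto
  have inter: "(w, i) \<in> part True \<Longrightarrow> x \<in> A w i" "(w, i) \<in> part False \<Longrightarrow> - x \<in> A w i" for w i
    using hold[of "(w, i, True)"] hold[of "(w, i, False)"] by (simp_all add: part_def holds_def signed_def)
  then have x_in: "x \<in> (\<Inter>(w, i)\<in>part True. A w i) \<inter> (\<Inter>(w, i)\<in>part False. uminus ` A w i)"
    by (auto intro: image_eqI[where x = "- x"])
  have disj: "part True \<inter> part False = {}"
    using inj_onD[OF inj, of "(_, _, True)" "(_, _, False)"] by (auto simp: part_def)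
  have inj': "inj_on fst (part True \<union> part False)"
    using inj by (fastforce simp: part_def inj_on_def)
  have fst_eq: "fst ` (part True \<union> part False) = fst ` J"
  proof (intro equalityI subsetI)
    fix w assume "w \<in> fst ` J"
    then obtain i s where "(w, i, s) \<in> J" by auto
    then show "w \<in> fst ` (part True \<union> part False)" by (cases s) (force simp: part_def)+
  qed (force simp: part_def)
  have rank: "matroid_rank M (fst ` J) = d + 1"
    unfolding matroid_rank_def
  proof (rule Max_eqI)
    show "finite (card ` {I\<in>M. I \<subseteq> fst ` J})" using finite_M by simp
    have "card (fst ` J) = d + 1" using J(2) card_image[OF inj] by simp
    then show "d + 1 \<in> card ` {I\<in>M. I \<subseteq> fst ` J}" "\<And>y. y \<in> card ` {I\<in>M. I \<subseteq> fst ` J} \<Longrightarrow> y \<le> d + 1"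
      using JM finJ by (auto intro: image_eqI[of _ _ "fst ` J"], metis card_mono finite_imageI)
  qed
  have snds: "snd ` part True \<inter> snd ` part False = {}"
  proof (rule ccontr)
    assume "\<not> ?thesis"
    then obtain w w' i where wi: "(w, i) \<in> part True" "(w', i) \<in> part False" by auto
    then have "{w, w'} \<subseteq> fst ` J" by (force simp: part_def)
    then have "{w, w'} \<in> M" using matroid_subset[OF M JM] by blast
    moreover have "x \<in> A w i \<inter> uminus ` A w' i"
      using inter wi by (auto intro: image_eqI[where x = "- x"])
    ultimately show False using assms(9) wi part_sub by blast
  qed
  show ?thesis
    using x part_sub ne disj hulls x_in inj' fst_eq JM rank snds
    by (intro bexI[of _ x] exI[of _ "part True"] exI[of _ "part False"]) auto
qed

end
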